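(* Let $X,Y$ be infinite-dimensional complex Hilbert spaces, let $W\in\mathcal{B}(Y,X)\setminus\{0\}$ and let $A\in\mathcal{B}(X,Y)$ be $W$g-Drazin invertible. Then the following statements hold: (i) $A^{\otimes,W}=A^{\mathrm{cEP},W}P_{R(WA^{d,W}),\,N(A^{\mathrm{cEP},W}WA)}$; (ii) $A^{\otimes,W}=A^{d,W}P_{R(WA^{d,W}),\,N(A^{\mathrm{cEP},W}WA)}$; (iii) $WP_{R((AW)^d)}$ is Moore–Penrose invertible, $WA(WA)^{\mathrm{cEP}}WA$ is group invertible and $$A^{\otimes,W}=(WP_{R((AW)^d)})^\dagger\,(WA(WA)^{\mathrm{cEP}}WA)^\#=(WP_{R((AW)^d)})^\dagger\,(P_{R((WA)^d)}WA)^\#;$$ (iv) $A^{\otimes,W}=[(AW)^2]^{\mathrm{cEP}}AWA^{\mathrm{cEP},W}WA=[(AW)^2]^{\mathrm{cEP}}AP_{R(WA^{d,W}),\,N(A^{\mathrm{cEP},W}WA)}$; (v) $WP_{R((AW)^d)}$ is Moore–Penrose invertible and $A^{\otimes,W}=[(AW)^d]^2(WP_{R((AW)^d)})^\dagger WA$; (vi) $WP_{R((AW)^d)}$ is Moore–Penrose invertible and $A^{\otimes,W}=(WP_{R((AW)^d)})^\dagger[(WA)^2]^{\mathrm{cEP}}WA$; (vii) $(AW)^3(AW)^d$ is group invertible and $A^{\otimes,W}=[(AW)^3(AW)^d]^{\mathrm{core}}AWA^{\mathrm{cEP},W}WA$.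
   Context: $\mathcal{B}(X,Y)$ is the set of bounded linear operators from $X$ to $Y$, $\mathcal{B}(X)=\mathcal{B}(X,X)$; $R(\cdot)$, $N(\cdot)$ denote range and null space; $P_L$ is the orthogonal projector onto a closed subspace $L$; $P_{L,M}$ is the idempotent with range $L$ and null space $M$; $(\cdot)^\dagger$ is the Moore–Penrose inverse and $(\cdot)^\#$ the group inverse. An operator $T\in\mathcal{B}(X)$ is generalized Drazin invertible if there is a (necessarily unique) $T^d\in\mathcal{B}(X)$ with $TT^d=T^dT$, $T^dTT^d=T^d$ and $T-T^2T^d$ quasinilpotent (and similarly on $Y$). $T$ is group invertible if moreover $T=T^2T^d$, and then $T^\#=T^d$. For $W\in\mathcal{B}(Y,X)\setminus\{0\}$, an operator $A\in\mathcal{B}(X,Y)$ is $W$g-Drazin invertible if there is a (necessarily unique) $A^{d,W}=B\in\mathcal{B}(X,Y)$ with $AWB=BWA$, $BWAWB=B$ and $A-AWBWA$ quasinilpotent in the weighted sense, i.e. $(A-AWBWA)W$ is a quasinilpotent operator on $Y$. In that case $AW$ and $WA$ are generalized Drazin invertible with $(AW)^d=A^{d,W}W$ and $(WA)^d=WA^{d,W}$. If $A$ is $W$g-Drazin invertible, its weighted core-EP inverse $A^{\mathrm{cEP},W}$ is the unique (it exists) operator $B\in\mathcal{B}(X,Y)$ with $WAWB=P_{R((WA)^d)}$ and $R(B)\subseteq R((AW)^d)$. For a generalized Drazin invertible operator $T$ on a Hilbert space, the core-EP inverse $T^{\mathrm{cEP}}$ is the unique operator $B$ with $TB=P_{R(T^d)}$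 and $R(B)\subseteq R(T^d)$; if $T$ is group invertible, $T^{\mathrm{cEP}}$ is called the core inverse of $T$ and denoted $T^{\mathrm{core}}$. The weighted weak group inverse of $A$ is $A^{\otimes,W}=(A^{\mathrm{cEP},W}W)^2A$. *)

theory Defs
  imports "HOL-Analysis.Analysis"
begin

section \<open>Complex Hilbert spaces\<close>

text \<open>The norm, the topology and completeness are those of the library class \<^class>\<open>banach\<close>;
  the last axiom says that the norm is induced by the inner product, and it contains positive
  definiteness. The inner product is linear in its first argument.\<close>

class chilbert_space = banach +
  fixes scaleC :: "complex \<Rightarrow> 'a \<Rightarrow> 'a" (infixr "*\<^sub>C" 75)
    and cinner :: "'a \<Rightarrow> 'a \<Rightarrow> complex"
  assumes scaleR_scaleC: "r *\<^sub>R x = complex_of_real r *\<^sub>C x"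
    and scaleC_add_right: "c *\<^sub>C (x + y) = c *\<^sub>C x + c *\<^sub>C y"
    and scaleC_add_left: "(c + d) *\<^sub>C x = c *\<^sub>C x + d *\<^sub>C x"
    and scaleC_scaleC: "c *\<^sub>C d *\<^sub>C x = (c * d) *\<^sub>C x"
    and cinner_commute: "cinner x y = cnj (cinner y x)"
    and cinner_add_left: "cinner (x + y) z = cinner x z + cinner y z"
    and cinner_scaleC_left: "cinner (c *\<^sub>C x) y = c * cinner x y"
    and cinner_same: "cinner x x = complex_of_real ((norm x)\<^sup>2)"

lemma scaleC_one: "1 *\<^sub>C (x :: 'a::chilbert_space) = x"
  using scaleR_scaleC[of 1 x] by simp

global_interpretation complex_vector: vector_space "scaleC :: complex \<Rightarrow> 'a::chilbert_space \<Rightarrow> 'a"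
  by unfold_locales (simp_all add: scaleC_add_right scaleC_add_left scaleC_scaleC scaleC_one)

definition infinite_cdim :: "'a::chilbert_space itself \<Rightarrow> bool" where
  "infinite_cdim _ \<longleftrightarrow> (\<nexists>F :: 'a set. finite F \<and> complex_vector.span F = UNIV)"

definition orth_compl :: "'a::chilbert_space set \<Rightarrow> 'a set" where
  "orth_compl L = {x. \<forall>y\<in>L. cinner x y = 0}"

section \<open>Bounded complex-linear operators\<close>

text \<open>The type \<^typ>\<open>'a \<Rightarrow>\<^sub>L 'b\<close> consists of the bounded real-linear maps. The set
  \<open>cblinops\<close> of its complex-linear members is the space of bounded operators meant in
  what follows, and every operator introduced below is required to lie in it.\<close>

definition cblinops :: "('a::chilbert_space \<Rightarrow>\<^sub>L 'b::chilbert_space) set" where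
  "cblinops = {T. \<forall>c x. blinfun_apply T (c *\<^sub>C x) = c *\<^sub>C blinfun_apply T x}"

definition Ran :: "('a::real_normed_vector \<Rightarrow>\<^sub>L 'b::real_normed_vector) \<Rightarrow> 'b set" where
  "Ran T = range (blinfun_apply T)"

definition Nul :: "('a::real_normed_vector \<Rightarrow>\<^sub>L 'b::real_normed_vector) \<Rightarrow> 'a set" where
  "Nul T = {x. blinfun_apply T x = 0}"

definition self_adjoint :: "('a::chilbert_space \<Rightarrow>\<^sub>L 'a) \<Rightarrow> bool" where
  "self_adjoint T \<longleftrightarrow> (\<forall>x y. cinner (blinfun_apply T x) y = cinner x (blinfun_apply T y))"

definition idem_proj :: "'a::chilbert_space set \<Rightarrow> 'a set \<Rightarrow> ('a \<Rightarrow>\<^sub>L 'a)" where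
  "idem_proj L M = (THE P. P \<in> cblinops \<and> P o\<^sub>L P = P \<and> Ran P = L \<and> Nul P = M)"

definition orth_proj :: "'a::chilbert_space set \<Rightarrow> ('a \<Rightarrow>\<^sub>L 'a)" where
  "orth_proj L = idem_proj L (orth_compl L)"

text \<open>The spectrum consists of the \<open>c\<close> such that \<open>c I - T\<close> has no two-sided inverse among
  the bounded complex-linear operators.\<close>

definition cspectrum :: "('a::chilbert_space \<Rightarrow>\<^sub>L 'a) \<Rightarrow> complex set" where
  "cspectrum T = {c. \<not> (\<exists>S\<in>cblinops.
     (\<forall>x. blinfun_apply S (c *\<^sub>C x - blinfun_apply T x) = x) \<and>
     (\<forall>x. c *\<^sub>C blinfun_apply S x - blinfun_apply T (blinfun_apply S x) = x))}"

definition quasinilpotent :: "('a::chilbert_space \<Rightarrow>\<^sub>L 'a) \<Rightarrow> bool" where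
  "quasinilpotent T \<longleftrightarrow> cspectrum T = {0}"

section \<open>Generalized inverses\<close>

text \<open>An inverse defined by \<open>THE\<close> is meaningful only if the corresponding operator exists.\<close>

definition is_mp_inverse ::
    "('a::chilbert_space \<Rightarrow>\<^sub>L 'b::chilbert_space) \<Rightarrow> ('b \<Rightarrow>\<^sub>L 'a) \<Rightarrow> bool" where
  "is_mp_inverse T S \<longleftrightarrow> S \<in> cblinops \<and>
     T o\<^sub>L S o\<^sub>L T = T \<and> S o\<^sub>L T o\<^sub>L S = S \<and>
     self_adjoint (T o\<^sub>L S) \<and> self_adjoint (S o\<^sub>L T)"

definition mp_invertible :: "('a::chilbert_space \<Rightarrow>\<^sub>L 'b::chilbert_space) \<Rightarrow> bool" where
  "mp_invertible T \<longleftrightarrow> (\<exists>S. is_mp_inverse T S)"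

definition mp_inverse :: "('a::chilbert_space \<Rightarrow>\<^sub>L 'b::chilbert_space) \<Rightarrow> ('b \<Rightarrow>\<^sub>L 'a)" where
  "mp_inverse T = (THE S. is_mp_inverse T S)"

definition is_gdrazin_inverse :: "('a::chilbert_space \<Rightarrow>\<^sub>L 'a) \<Rightarrow> ('a \<Rightarrow>\<^sub>L 'a) \<Rightarrow> bool" where
  "is_gdrazin_inverse T S \<longleftrightarrow> S \<in> cblinops \<and>
     T o\<^sub>L S = S o\<^sub>L T \<and> S o\<^sub>L T o\<^sub>L S = S \<and>
     quasinilpotent (T - (T o\<^sub>L T o\<^sub>L S))"

definition gdrazin_invertible :: "('a::chilbert_space \<Rightarrow>\<^sub>L 'a) \<Rightarrow> bool" where
  "gdrazin_invertible T \<longleftrightarrow> (\<exists>S. is_gdrazin_inverse T S)"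

definition gdrazin_inverse :: "('a::chilbert_space \<Rightarrow>\<^sub>L 'a) \<Rightarrow> ('a \<Rightarrow>\<^sub>L 'a)" where
  "gdrazin_inverse T = (THE S. is_gdrazin_inverse T S)"

definition group_invertible :: "('a::chilbert_space \<Rightarrow>\<^sub>L 'a) \<Rightarrow> bool" where
  "group_invertible T \<longleftrightarrow> gdrazin_invertible T \<and> T = T o\<^sub>L T o\<^sub>L gdrazin_inverse T"

definition group_inverse :: "('a::chilbert_space \<Rightarrow>\<^sub>L 'a) \<Rightarrow> ('a \<Rightarrow>\<^sub>L 'a)" where
  "group_inverse T = gdrazin_inverse T"

definition core_ep_inverse :: "('a::chilbert_space \<Rightarrow>\<^sub>L 'a) \<Rightarrow> ('a \<Rightarrow>\<^sub>L 'a)" where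
  "core_ep_inverse T = (THE B. B \<in> cblinops \<and>
     T o\<^sub>L B = orth_proj (Ran (gdrazin_inverse T)) \<and> Ran B \<subseteq> Ran (gdrazin_inverse T))"

definition core_inverse :: "('a::chilbert_space \<Rightarrow>\<^sub>L 'a) \<Rightarrow> ('a \<Rightarrow>\<^sub>L 'a)" where
  "core_inverse T = core_ep_inverse T"

section \<open>Weighted generalized inverses\<close>

definition is_wgdrazin_inverse :: "('y::chilbert_space \<Rightarrow>\<^sub>L 'x::chilbert_space) \<Rightarrow>
    ('x \<Rightarrow>\<^sub>L 'y) \<Rightarrow> ('x \<Rightarrow>\<^sub>L 'y) \<Rightarrow> bool" where
  "is_wgdrazin_inverse W A B \<longleftrightarrow> B \<in> cblinops \<and>
     A o\<^sub>L W o\<^sub>L B = B o\<^sub>L W o\<^sub>L A \<and> B o\<^sub>L W o\<^sub>L A o\<^sub>L W o\<^sub>L B = B \<and>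
     quasinilpotent ((A - (A o\<^sub>L W o\<^sub>L B o\<^sub>L W o\<^sub>L A)) o\<^sub>L W)"

definition wgdrazin_invertible ::
    "('y::chilbert_space \<Rightarrow>\<^sub>L 'x::chilbert_space) \<Rightarrow> ('x \<Rightarrow>\<^sub>L 'y) \<Rightarrow> bool" where
  "wgdrazin_invertible W A \<longleftrightarrow> (\<exists>B. is_wgdrazin_inverse W A B)"

definition wgdrazin_inverse ::
    "('y::chilbert_space \<Rightarrow>\<^sub>L 'x::chilbert_space) \<Rightarrow> ('x \<Rightarrow>\<^sub>L 'y) \<Rightarrow> ('x \<Rightarrow>\<^sub>L 'y)" where
  "wgdrazin_inverse W A = (THE B. is_wgdrazin_inverse W A B)"

definition wcore_ep_inverse ::
    "('y::chilbert_space \<Rightarrow>\<^sub>L 'x::chilbert_space) \<Rightarrow> ('x \<Rightarrow>\<^sub>L 'y) \<Rightarrow> ('x \<Rightarrow>\<^sub>L 'y)" where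
  "wcore_ep_inverse W A = (THE B. B \<in> cblinops \<and>
     W o\<^sub>L A o\<^sub>L W o\<^sub>L B = orth_proj (Ran (gdrazin_inverse (W o\<^sub>L A))) \<and>
     Ran B \<subseteq> Ran (gdrazin_inverse (A o\<^sub>L W)))"

definition wweak_group_inverse ::
    "('y::chilbert_space \<Rightarrow>\<^sub>L 'x::chilbert_space) \<Rightarrow> ('x \<Rightarrow>\<^sub>L 'y) \<Rightarrow> ('x \<Rightarrow>\<^sub>L 'y)" where
  "wweak_group_inverse W A =
     (wcore_ep_inverse W A o\<^sub>L W) o\<^sub>L (wcore_ep_inverse W A o\<^sub>L W) o\<^sub>L A"

end

(* With B the weighted generalized Drazin inverse of A, and P, Q the orthogonal projectors onto
   R(BW) = R((AW)^d) and R(WB) = R((WA)^d), every operator in the theorem is an explicit word in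
   A, W, B, P, Q: the weighted core-EP inverse is BQ, the weighted weak group inverse BWBQWA, the
   idempotent WBQWA, the Moore-Penrose inverse of WP is BWAQ, the core-EP inverse of a generalized
   Drazin invertible T is T^d times the orthogonal projector onto R(T^d), and the group inverse of
   QWA is WBWBQWA. The identities then follow from AWB = BWA, BWAWB = B and the fixed-point
   equations of P and Q. Uniqueness of the generalized Drazin inverse rests on the fact that
   Z = 0 if Z = SZN or Z = NZS with S bounded and N quasinilpotent: the resolvent of N composed with Z is then an
   entire function vanishing at infinity. *)
theory Submission
  imports Defs "HOL-Complex_Analysis.Cauchy_Integral_Formula"
begin

section \<open>The inner product\<close>

lemma cinner_add_right: "cinner x (y + z) = cinner x y + cinner x z"
  by (metis cinner_add_left cinner_commute complex_cnj_add)

lemma cinner_scaleC_right: "cinner x (c *\<^sub>C y) = cnj c * cinner x y"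
  by (metis cinner_scaleC_left cinner_commute complex_cnj_mult)

lemma cinner_zero [simp]: "cinner 0 y = 0" "cinner x 0 = 0"
  using cinner_add_left[of 0 0 y] cinner_add_right[of x 0 0] by auto

lemma cinner_diff_left: "cinner (x - y) z = cinner x z - cinner y z"
  using cinner_add_left[of "x - y" y z] by simp

lemma cinner_diff_right: "cinner x (y - z) = cinner x y - cinner x z"
  using cinner_add_right[of x "y - z" z] by simp

lemma cinner_self_eq_0_iff: "cinner x x = 0 \<longleftrightarrow> x = 0"
  by (simp add: cinner_same)

lemma cinner_left_ext: "(\<And>v. cinner x v = cinner y v) \<Longrightarrow> x = y"
  by (metis cinner_diff_left cinner_self_eq_0_iff diff_self eq_iff_diff_eq_0)

lemma norm_sq_cinner: "(norm x)\<^sup>2 = Re (cinner x x)"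
  by (simp add: cinner_same)

text \<open>The class states no norm law for complex scalars; it is extracted from
  \<open>cinner_same\<close>.\<close>

lemma norm_scaleC: "norm (c *\<^sub>C x) = cmod c * norm x"
proof -
  have "complex_of_real ((norm (c *\<^sub>C x))\<^sup>2) = c * cnj c * complex_of_real ((norm x)\<^sup>2)"
    by (simp only: cinner_same[symmetric] cinner_scaleC_left cinner_scaleC_right) simp
  also have "\<dots> = complex_of_real ((cmod c * norm x)\<^sup>2)"
    by (simp add: complex_norm_square[symmetric] power_mult_distrib)
  finally have "(norm (c *\<^sub>C x))\<^sup>2 = (cmod c * norm x)\<^sup>2"
    using of_real_eq_iff by blast
  thus ?thesis by simp
qed

lemma parallelogram:
  "(norm (x + y))\<^sup>2 + (norm (x - y))\<^sup>2 = 2 * (norm x)\<^sup>2 + 2 * (norm (y :: 'a::chilbert_space))\<^sup>2"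
  by (simp add: norm_sq_cinner cinner_add_left cinner_add_right cinner_diff_left cinner_diff_right)

lemma pythagoras: "cinner x y = 0 \<Longrightarrow> (norm (x + y))\<^sup>2 = (norm x)\<^sup>2 + (norm y)\<^sup>2"
  using cinner_commute[of y x]
  by (simp add: norm_sq_cinner cinner_add_left cinner_add_right)

text \<open>The subtracted vector is the orthogonal component of e along z, so Pythagoras applies.
  The loss term drives both Cauchy-Schwarz and the nearest-point argument.\<close>

lemma norm_minus_component:
  assumes "z \<noteq> 0"
  shows "(norm (e - (cinner e z / complex_of_real ((norm z)\<^sup>2)) *\<^sub>C z))\<^sup>2
    = (norm e)\<^sup>2 - (cmod (cinner e z))\<^sup>2 / (norm z)\<^sup>2"
proof -
  define n where "n = complex_of_real ((norm z)\<^sup>2)"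
  have n: "n \<noteq> 0" "cinner z z = n" "cnj n = n" using assms by (auto simp: n_def cinner_same)
  define w where "w = (cinner e z / n) *\<^sub>C z"
  have "cinner (e - w) w = 0"
    using n by (simp add: w_def cinner_diff_left cinner_scaleC_left cinner_scaleC_right)
  hence "(norm e)\<^sup>2 = (norm (e - w))\<^sup>2 + (norm w)\<^sup>2" using pythagoras[of "e - w" w] by simp
  moreover have "(norm w)\<^sup>2 = (cmod (cinner e z))\<^sup>2 / (norm z)\<^sup>2"
    using assms by (simp add: w_def n_def norm_scaleC norm_divide norm_mult power2_eq_square)
  ultimately show ?thesis by (simp add: w_def n_def)
qed

lemma Cauchy_Schwarz: "cmod (cinner x y) \<le> norm x * norm y"
proof (cases "y = 0")
  case False
  hence "(cmod (cinner x y))\<^sup>2 / (norm y)\<^sup>2 \<le> (norm x)\<^sup>2"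
    using norm_minus_component[of y x] by (metis diff_ge_0_iff_ge zero_le_power2)
  hence "(cmod (cinner x y))\<^sup>2 \<le> (norm x * norm y)\<^sup>2"
    using False by (simp add: divide_le_eq power_mult_distrib)
  thus ?thesis by (rule power2_le_imp_le) simp
qed simp

section \<open>Orthogonal projections\<close>

text \<open>A minimizing sequence is Cauchy: the midpoint of two near-minimizers stays in L, so it
  is no closer than d, and the parallelogram law then bounds their gap.\<close>

lemma closest_point_exists:
  fixes x :: "'a::chilbert_space"
  assumes L: "closed L" "complex_vector.subspace L"
  obtains y where "y \<in> L" "\<And>z. z \<in> L \<Longrightarrow> norm (x - y) \<le> norm (x - z)"
proof -
  define d where "d = infdist x L"
  have ne: "L \<noteq> {}" using complex_vector.subspace_0[OF L(2)] by auto
  have dle: "d \<le> norm (x - z)" if "z \<in> L" for z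
    using infdist_le[OF that, of x] by (simp add: d_def dist_norm)
  have d0: "d \<ge> 0" by (simp add: d_def infdist_nonneg)
  have "\<exists>y\<in>L. (norm (x - y))\<^sup>2 < d\<^sup>2 + 1 / real (Suc n)" for n
  proof -
    have "sqrt (d\<^sup>2 + 1 / real (Suc n)) > sqrt (d\<^sup>2)" by (subst real_sqrt_less_iff) simp
    hence "sqrt (d\<^sup>2 + 1 / real (Suc n)) > infdist x L" using d0 by (simp add: d_def)
    then obtain y where "y \<in> L" "dist x y < sqrt (d\<^sup>2 + 1 / real (Suc n))"
      unfolding infdist_notempty[OF ne] using cInf_lessD[of "dist x ` L"] ne by blast
    moreover have "(norm (x - y))\<^sup>2 < (sqrt (d\<^sup>2 + 1 / real (Suc n)))\<^sup>2"
      using calculation(2) by (intro power_strict_mono) (auto simp: dist_norm)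
    ultimately show ?thesis by auto
  qed
  then obtain y where y: "\<And>n. y n \<in> L" "\<And>n. (norm (x - y n))\<^sup>2 < d\<^sup>2 + 1 / real (Suc n)"
    by metis
  have bound: "(norm (y m - y n))\<^sup>2 \<le> 2 / real (Suc n) + 2 / real (Suc m)" for m n
  proof -
    define mid where "mid = (1/2) *\<^sub>R (y n + y m)"
    have "mid \<in> L" unfolding mid_def scaleR_scaleC
      by (intro complex_vector.subspace_scale complex_vector.subspace_add L y)
    hence "d\<^sup>2 \<le> (norm (x - mid))\<^sup>2" using dle d0 by (intro power_mono)
    moreover have "(x - y n) + (x - y m) = 2 *\<^sub>R (x - mid)"
      by (simp add: mid_def scaleR_diff_right scaleR_2)
    hence "(norm ((x - y n) + (x - y m)))\<^sup>2 = 4 * (norm (x - mid))\<^sup>2"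
      by (simp add: power_mult_distrib)
    moreover have "(x - y n) - (x - y m) = y m - y n" by simp
    ultimately show ?thesis
      using parallelogram[of "x - y n" "x - y m"] y(2)[of n] y(2)[of m] by simp
  qed
  have "Cauchy y"
  proof (rule metric_CauchyI)
    fix e :: real assume e: "e > 0"
    \<comment> \<open>With \<open>4 / e^2 < N\<close>, each of the two terms in \<open>bound\<close>
      is below \<open>e^2 / 2\<close>.\<close>
    obtain N where N: "4 / e\<^sup>2 < real N" using reals_Archimedean2 by blast
    have "dist (y m) (y n) < e" if "m \<ge> N" "n \<ge> N" for m n
    proof -
      have "4 / e\<^sup>2 < real (Suc k)" if "k \<ge> N" for k using N that by linarith
      hence "2 / real (Suc k) < e\<^sup>2 / 2" if "k \<ge> N" for k
        using e that by (simp add: divide_less_eq field_simps)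
      from this[OF that(1)] this[OF that(2)] have "(norm (y m - y n))\<^sup>2 < e\<^sup>2"
        using bound[of m n] by linarith
      thus ?thesis using e by (simp add: dist_norm power2_less_imp_less)
    qed
    thus "\<exists>M. \<forall>m\<ge>M. \<forall>n\<ge>M. dist (y m) (y n) < e" by blast
  qed
  then obtain l where l: "y \<longlonglongrightarrow> l" using Cauchy_convergent_iff convergent_def by blast
  have "l \<in> L" using closed_sequentially[OF L(1) _ l] y(1) by blast
  moreover have "norm (x - l) \<le> norm (x - z)" if z: "z \<in> L" for z
  proof -
    have 1: "(\<lambda>n. (norm (x - y n))\<^sup>2) \<longlonglongrightarrow> (norm (x - l))\<^sup>2" by (intro tendsto_intros l)
    have 2: "(\<lambda>n. d\<^sup>2 + 1 / real (Suc n)) \<longlonglongrightarrow> d\<^sup>2 + 0"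
      by (intro tendsto_intros lim_1_over_real_power[of 1, simplified])
        (use LIMSEQ_inverse_real_of_nat in \<open>simp add: divide_inverse\<close>)
    have "(norm (x - l))\<^sup>2 \<le> d\<^sup>2"
      using LIMSEQ_le[OF 1 2] y(2) by (auto intro: less_imp_le)
    hence "norm (x - l) \<le> d" using d0 by (rule power2_le_imp_le)
    with dle[OF z] show ?thesis by simp
  qed
  ultimately show ?thesis using that by blast
qed

text \<open>For y nearest to x, removing from \<open>x - y\<close> its component along some z in L
  cannot shorten it, so the drop given by \<open>norm_minus_component\<close> vanishes.\<close>

lemma orth_decomposition:
  fixes x :: "'a::chilbert_space"
  assumes L: "closed L" "complex_vector.subspace L"
  obtains y where "y \<in> L" "x - y \<in> orth_compl L"
proof -
  obtain y where y: "y \<in> L" "\<And>z. z \<in> L \<Longrightarrow> norm (x - y) \<le> norm (x - z)"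
    using closest_point_exists[OF L] by metis
  have "cinner (x - y) z = 0" if z: "z \<in> L" for z
  proof (cases "z = 0")
    case False
    define c where "c = cinner (x - y) z / complex_of_real ((norm z)\<^sup>2)"
    have "y + c *\<^sub>C z \<in> L"
      by (intro complex_vector.subspace_add complex_vector.subspace_scale L y z)
    hence "norm (x - y) \<le> norm ((x - y) - c *\<^sub>C z)" using y(2) by (metis diff_diff_eq)
    hence "(norm (x - y))\<^sup>2 \<le> (norm ((x - y) - c *\<^sub>C z))\<^sup>2" by (intro power_mono) auto
    hence "(cmod (cinner (x - y) z))\<^sup>2 / (norm z)\<^sup>2 \<le> 0"
      unfolding c_def norm_minus_component[OF False] by simp
    thus ?thesis using False by (simp add: divide_le_0_iff)
  qed simp
  thus ?thesis using that y by (auto simp: orth_compl_def)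
qed

text \<open>Split x as \<open>P x + (x - P x)\<close>: any rival idempotent fixes the first summand
  and kills the second.\<close>

lemma idem_proj_eqI:
  assumes "P \<in> cblinops" "P o\<^sub>L P = P" "Ran P = L" "Nul P = M"
  shows "idem_proj L M = P"
  unfolding idem_proj_def
proof (rule the_equality)
  fix S assume S: "S \<in> cblinops \<and> S o\<^sub>L S = S \<and> Ran S = L \<and> Nul S = M"
  show "S = P"
  proof (rule blinfun_eqI)
    fix x
    have idem: "S (S y) = S y" "P (P y) = P y" for y
      using S assms(2) by (metis blinfun_apply_blinfun_compose)+
    have "x - P x \<in> Nul S" using S assms(4) idem by (auto simp: Nul_def blinfun.diff_right)
    hence "S x = S (P x)" by (simp add: Nul_def blinfun.diff_right)
    moreover have "P x \<in> Ran S" using S assms(3) by (auto simp: Ran_def)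
    hence "S (P x) = P x" using idem by (auto simp: Ran_def)
    ultimately show "S x = P x" by simp
  qed
qed (use assms in auto)

text \<open>The projector is assembled from chosen orthogonal decompositions; Pythagoras bounds it
  by 1, and \<open>idem_proj_eqI\<close> identifies it with \<open>orth_proj\<close>.\<close>

lemma orth_proj_properties:
  fixes L :: "'a::chilbert_space set"
  assumes L: "closed L" "complex_vector.subspace L"
  shows "orth_proj L \<in> cblinops" "Ran (orth_proj L) = L" "self_adjoint (orth_proj L)"
    "x \<in> L \<Longrightarrow> orth_proj L x = x"
proof -
  have "\<forall>x. \<exists>y. y \<in> L \<and> x - y \<in> orth_compl L" using orth_decomposition[OF L] by metis
  then obtain p where p: "\<And>x. p x \<in> L" "\<And>x. x - p x \<in> orth_compl L" by metis
  have ocs: "complex_vector.subspace (orth_compl L)"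
    by (rule complex_vector.subspaceI)
      (auto simp: orth_compl_def cinner_add_left cinner_scaleC_left)
  \<comment> \<open>Two candidates differ by a vector lying in L and in its complement, hence
    orthogonal to itself. Linearity and the null space both rest on this.\<close>
  have uniq: "p x = y" if "y \<in> L" "x - y \<in> orth_compl L" for x y
  proof -
    have "p x - y \<in> L" using that(1) p(1) complex_vector.subspace_diff[OF L(2)] by blast
    moreover have "(x - y) - (x - p x) \<in> orth_compl L"
      using that(2) p(2) complex_vector.subspace_diff[OF ocs] by blast
    hence "p x - y \<in> orth_compl L" by simp
    ultimately have "cinner (p x - y) (p x - y) = 0" by (auto simp: orth_compl_def)
    thus ?thesis by (simp add: cinner_self_eq_0_iff)
  qed
  have add: "p (x + y) = p x + p y" for x y
  proof (rule uniq)
    have "(x - p x) + (y - p y) \<in> orth_compl L"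
      using p(2) complex_vector.subspace_add[OF ocs] by blast
    thus "x + y - (p x + p y) \<in> orth_compl L" by (simp add: algebra_simps)
  qed (use p(1) complex_vector.subspace_add[OF L(2)] in blast)
  have scale: "p (c *\<^sub>C x) = c *\<^sub>C p x" for c x
  proof (rule uniq)
    have "c *\<^sub>C (x - p x) \<in> orth_compl L"
      using p(2) complex_vector.subspace_scale[OF ocs] by blast
    thus "c *\<^sub>C x - c *\<^sub>C p x \<in> orth_compl L"
      by (simp add: complex_vector.scale_right_diff_distrib)
  qed (use p(1) complex_vector.subspace_scale[OF L(2)] in blast)
  have le: "norm (p x) \<le> norm x" for x
  proof -
    have "cinner (x - p x) (p x) = 0" using p by (auto simp: orth_compl_def)
    from pythagoras[OF this] have "(norm (p x))\<^sup>2 \<le> (norm x)\<^sup>2" by simp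
    thus ?thesis by (rule power2_le_imp_le) simp
  qed
  have bl: "bounded_linear p"
    by (rule bounded_linear_intro[where K = 1]) (auto simp: add scale scaleR_scaleC le)
  define P where "P = Blinfun p"
  have P: "blinfun_apply P = p" unfolding P_def by (rule bounded_linear_Blinfun_apply[OF bl])
  have fixL: "p x = x" if "x \<in> L" for x
    using uniq[of x x] that complex_vector.subspace_0[OF ocs] by simp
  have cb: "P \<in> cblinops" by (simp add: cblinops_def P scale)
  have ran: "Ran P = L"
  proof
    show "L \<subseteq> Ran P" using fixL by (metis P Ran_def rangeI subsetI)
  qed (use p(1) in \<open>auto simp: Ran_def P\<close>)
  have nul: "Nul P = orth_compl L"

  proof
    show "Nul P \<subseteq> orth_compl L" using p(2) by (metis (mono_tags) Nul_def P diff_zero mem_Collect_eq subsetI)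
  qed (use uniq[of 0] complex_vector.subspace_0[OF L(2)] in \<open>auto simp: Nul_def P\<close>)
  have eq: "orth_proj L = P" unfolding orth_proj_def
    by (rule idem_proj_eqI) (use cb ran nul p(1) fixL in \<open>auto intro!: blinfun_eqI simp: P\<close>)
  have sa: "cinner (p x) y = cinner x (p y)" for x y
  proof -
    have "cinner (y - p y) (p x) = 0" "cinner (x - p x) (p y) = 0"
      using p by (auto simp: orth_compl_def)
    thus ?thesis
      by (metis cinner_commute cinner_diff_left complex_cnj_zero cinner_diff_right right_minus_eq)
  qed
  show "orth_proj L \<in> cblinops" "Ran (orth_proj L) = L" "self_adjoint (orth_proj L)"
    "x \<in> L \<Longrightarrow> orth_proj L x = x"
    using cb ran fixL by (auto simp: eq self_adjoint_def sa P)
qed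

section \<open>Complex-linear bounded operators\<close>

lemma cblinops_scaleC: "T \<in> cblinops \<Longrightarrow> T (c *\<^sub>C x) = c *\<^sub>C T x"
  by (simp add: cblinops_def)

lemma cblinops_compose: "S \<in> cblinops \<Longrightarrow> T \<in> cblinops \<Longrightarrow> S o\<^sub>L T \<in> cblinops"
  by (simp add: cblinops_def)

lemma cblinops_add: "S \<in> cblinops \<Longrightarrow> T \<in> cblinops \<Longrightarrow> S + T \<in> cblinops"
  by (simp add: cblinops_def blinfun.add_left scaleC_add_right)

lemma cblinops_diff: "S \<in> cblinops \<Longrightarrow> T \<in> cblinops \<Longrightarrow> S - T \<in> cblinops"
  by (simp add: cblinops_def blinfun.diff_left complex_vector.scale_right_diff_distrib)

lemma cblinops_id: "id_blinfun \<in> cblinops"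
  by (simp add: cblinops_def)

text \<open>The type of bounded real-linear maps offers only real multiples; complex multiples are
  formed by composing with this operator.\<close>

definition scaling :: "complex \<Rightarrow> 'a::chilbert_space \<Rightarrow>\<^sub>L 'a" where
  "scaling c = Blinfun (\<lambda>x. c *\<^sub>C x)"

lemma scaling_apply: "blinfun_apply (scaling c) x = c *\<^sub>C x"
proof -
  have "bounded_linear (\<lambda>x::'a. c *\<^sub>C x)"
    by (rule bounded_linear_intro[where K = "cmod c"])
      (auto simp: scaleC_add_right scaleR_scaleC scaleC_scaleC norm_scaleC mult.commute)
  thus ?thesis by (simp add: scaling_def bounded_linear_Blinfun_apply)
qed

lemma cblinops_scaling: "scaling c \<in> cblinops"
  by (simp add: cblinops_def scaling_apply scaleC_scaleC mult.commute)

section \<open>The resolvent of a quasinilpotent operator\<close>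

text \<open>The parameter is the reciprocal of the spectral one: \<open>R z\<close> inverts
  \<open>z Q - I\<close>. For quasinilpotent Q this exists at every z, 0 included, giving an entire
  family.\<close>

definition is_resolvent ::
    "('a::chilbert_space \<Rightarrow>\<^sub>L 'a) \<Rightarrow> (complex \<Rightarrow> ('a \<Rightarrow>\<^sub>L 'a)) \<Rightarrow> bool" where
  "is_resolvent Q R \<longleftrightarrow> (\<forall>z. R z \<in> cblinops) \<and>
     (\<forall>z x. R z (z *\<^sub>C Q x - x) = x) \<and> (\<forall>z x. z *\<^sub>C Q (R z x) - R z x = x)"

lemma quasinilpotent_resolvent:
  assumes "quasinilpotent Q" "Q \<in> cblinops"
  obtains R where "is_resolvent Q R"
proof -
  have "\<exists>T\<in>cblinops. (\<forall>x. T (z *\<^sub>C Q x - x) = x) \<and> (\<forall>x. z *\<^sub>C Q (T x) - T x = x)" for z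
  proof (cases "z = 0")
    case True
    thus ?thesis
      by (intro bexI[of _ "- id_blinfun"]) (auto simp: cblinops_def blinfun.minus_left blinfun.minus_right)
  next
    case False
    hence "inverse z \<notin> cspectrum Q" using assms by (simp add: quasinilpotent_def)
    then obtain S where S: "S \<in> cblinops" "\<And>x. S (inverse z *\<^sub>C x - Q x) = x"
      "\<And>x. inverse z *\<^sub>C S x - Q (S x) = x"
      by (auto simp: cspectrum_def)
    \<comment> \<open>\<open>z Q - I = -z (z^-1 I - Q)\<close>, and S inverts the second
      factor.\<close>
    define T where "T = scaling (- inverse z) o\<^sub>L S"
    have T: "T x = (- inverse z) *\<^sub>C S x" for x by (simp add: T_def scaling_apply)
    have "T (z *\<^sub>C Q x - x) = x" for x
    proof -
      have "T (z *\<^sub>C Q x - x) = S ((- inverse z) *\<^sub>C (z *\<^sub>C Q x - x))"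
        by (simp only: T cblinops_scaleC[OF S(1)])
      also have "(- inverse z) *\<^sub>C (z *\<^sub>C Q x - x) = inverse z *\<^sub>C x - Q x"
        using False by (simp add: complex_vector.scale_right_diff_distrib scaleC_scaleC scaleC_one)
      finally show ?thesis using S(2) by simp
    qed
    moreover have "z *\<^sub>C Q (T x) - T x = x" for x
    proof -
      have "z *\<^sub>C Q (T x) - T x = inverse z *\<^sub>C S x - Q (S x)"
        using False by (simp add: T cblinops_scaleC[OF assms(2)] scaleC_scaleC scaleC_one blinfun.minus_right)
      thus ?thesis using S(3) by simp
    qed
    moreover have "T \<in> cblinops"
      unfolding T_def by (intro cblinops_compose cblinops_scaling S)
    ultimately show ?thesis by blast
  qed
  hence "\<exists>R. \<forall>z. R z \<in> cblinops \<and> (\<forall>x. R z (z *\<^sub>C Q x - x) = x) \<and> (\<forall>x. z *\<^sub>C Q (R z x) - R z x = x)"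
    by metis
  thus ?thesis using that by (auto simp: is_resolvent_def)
qed

lemma is_resolventD:
  assumes "is_resolvent Q R"
  shows "R z \<in> cblinops" "R z (z *\<^sub>C Q x - x) = x" "z *\<^sub>C Q (R z x) - R z x = x"
  using assms by (auto simp: is_resolvent_def)

text \<open>Insert \<open>x = (z Q - I) R z x\<close> under \<open>R y\<close> and split
  \<open>z Q - I\<close> as \<open>(z - y) Q + (y Q - I)\<close>.\<close>

lemma resolvent_identity:
  assumes "is_resolvent Q R" "Q \<in> cblinops"
  shows "R y x - R z x = (z - y) *\<^sub>C R y (Q (R z x))"
proof -
  note R = is_resolventD[OF assms(1)]
  have "R y x = R y (z *\<^sub>C Q (R z x) - R z x)" by (simp add: R)
  also have "z *\<^sub>C Q (R z x) - R z x = (z - y) *\<^sub>C Q (R z x) + (y *\<^sub>C Q (R z x) - R z x)"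
    by (simp add: complex_vector.scale_left_diff_distrib)
  also have "R y \<dots> = (z - y) *\<^sub>C R y (Q (R z x)) + R z x"
    by (simp only: blinfun.add_right R(2) cblinops_scaleC[OF R(1)])
  finally show ?thesis by simp
qed

text \<open>By the resolvent identity, \<open>norm (R y)\<close> is at most
  \<open>norm (R z)\<close> plus \<open>|z - y| K norm (R y)\<close>, hence at most
  \<open>2 norm (R z)\<close> near z. With this local bound the identity gives convergence at each
  vector.\<close>

lemma resolvent_tendsto:
  assumes R: "is_resolvent Q R" "Q \<in> cblinops"
  shows "((\<lambda>y. R y x) \<longlongrightarrow> R z x) (at z)"
proof -
  define K where "K = norm (Q o\<^sub>L R z)"
  have le: "norm (R y x - R z x) \<le> cmod (z - y) * norm (R y) * norm (Q (R z x))" for y x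
    unfolding resolvent_identity[OF R] norm_scaleC mult.assoc
    by (intro mult_left_mono norm_blinfun) auto
  have bound: "norm (R y) \<le> 2 * norm (R z)" if "cmod (z - y) * K \<le> 1/2" for y
  proof -
    have "norm (R y) \<le> norm (R z) + norm (R y) * (cmod (z - y) * K)"
    proof (rule norm_blinfun_bound)
      show "0 \<le> norm (R z) + norm (R y) * (cmod (z - y) * K)" by (simp add: K_def)
      fix x
      have "norm (Q (R z x)) \<le> K * norm x"
        using norm_blinfun[of "Q o\<^sub>L R z" x] by (simp add: K_def)
      hence "norm (R y x - R z x) \<le> cmod (z - y) * norm (R y) * (K * norm x)"
        by (intro order_trans[OF le] mult_left_mono) auto
      moreover have "norm (R y x) \<le> norm (R z x) + norm (R y x - R z x)"
        by (metis norm_triangle_sub)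
      moreover have "norm (R z x) \<le> norm (R z) * norm x" by (rule norm_blinfun)
      ultimately show "norm (R y x) \<le> (norm (R z) + norm (R y) * (cmod (z - y) * K)) * norm x"
        by (simp add: algebra_simps)
    qed
    also have "\<dots> \<le> norm (R z) + norm (R y) * (1/2)"
      using that by (intro add_left_mono mult_left_mono) auto
    finally show ?thesis by simp
  qed
  have "((\<lambda>y. cmod (z - y) * K) \<longlongrightarrow> cmod (z - z) * K) (at z)" by (intro tendsto_intros)
  hence "eventually (\<lambda>y. cmod (z - y) * K < 1/2) (at z)"
    by (rule order_tendstoD) simp
  hence "eventually (\<lambda>y. norm (R y x - R z x) \<le> cmod (z - y) * (2 * norm (R z)) * norm (Q (R z x))) (at z)"
  proof eventually_elim
    case (elim y)
    thus ?case using bound[of y] by (intro order_trans[OF le] mult_right_mono mult_left_mono) auto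
  qed
  moreover have "((\<lambda>y. cmod (z - y) * (2 * norm (R z)) * norm (Q (R z x))) \<longlongrightarrow>
      cmod (z - z) * (2 * norm (R z)) * norm (Q (R z x))) (at z)"
    by (intro tendsto_intros)
  ultimately have "((\<lambda>y. R y x - R z x) \<longlongrightarrow> 0) (at z)"
    using Lim_null_comparison by fastforce
  thus ?thesis by (rule LIM_zero_cancel)
qed

section \<open>Weak holomorphy and the vanishing of intertwiners\<close>

lemma tendsto_cinner_left:
  assumes "(f \<longlongrightarrow> l) F"
  shows "((\<lambda>t. cinner (f t) v) \<longlongrightarrow> cinner l v) F"
proof -
  have lim: "((\<lambda>t. norm (f t - l) * norm v) \<longlongrightarrow> norm (l - l) * norm v) F" by (intro tendsto_intros assms)
  have "((\<lambda>t. cinner (f t) v - cinner l v) \<longlongrightarrow> 0) F"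
    by (rule Lim_null_comparison[OF always_eventually])
      (use lim in \<open>auto simp: cinner_diff_left[symmetric] Cauchy_Schwarz\<close>)
  thus ?thesis by (rule LIM_zero_cancel)
qed

text \<open>The resolvent identity turns the difference quotient into a matrix coefficient of
  \<open>R y\<close> at the fixed vector \<open>Q (R z u)\<close>; strong continuity supplies the
  limit.\<close>

lemma resolvent_holomorphic:
  assumes R: "is_resolvent Q R" "Q \<in> cblinops" and Z: "Z \<in> cblinops"
  shows "(\<lambda>z. cinner (Z (R z u)) v) holomorphic_on UNIV"
proof -
  have "((\<lambda>z. cinner (Z (R z u)) v) has_field_derivative - cinner (Z (R z (Q (R z u)))) v) (at z)" for z
    unfolding has_field_derivative_iff
  proof (rule Lim_transform_eventually)
    show "((\<lambda>y. - cinner (Z (R y (Q (R z u)))) v) \<longlongrightarrow> - cinner (Z (R z (Q (R z u)))) v) (at z)"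
      by (intro tendsto_minus tendsto_cinner_left blinfun.tendsto tendsto_const resolvent_tendsto[OF R])
    have "- cinner (Z (R y (Q (R z u)))) v = (cinner (Z (R y u)) v - cinner (Z (R z u)) v) / (y - z)"
      if "y \<noteq> z" for y
    proof -
      have "cinner (Z (R y u)) v - cinner (Z (R z u)) v = (z - y) * cinner (Z (R y (Q (R z u)))) v"
        by (simp add: cinner_diff_left[symmetric] blinfun.diff_right[symmetric]
            resolvent_identity[OF R] cblinops_scaleC[OF Z] cinner_scaleC_left)
      thus ?thesis using that by (simp add: field_simps)
    qed
    thus "\<forall>\<^sub>F y in at z. - cinner (Z (R y (Q (R z u)))) v =
        (cinner (Z (R y u)) v - cinner (Z (R z u)) v) / (y - z)"
      by (auto simp: eventually_at_filter)
  qed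
  thus ?thesis by (auto simp: holomorphic_on_open)
qed

text \<open>Far out, \<open>|f z|\<close> is at most \<open>M / (|z| - b)\<close>, so f tends to 0
  at infinity. The product form of the hypothesis avoids dividing where \<open>|z|\<close> does not
  exceed b.\<close>

lemma Liouville_decay:
  assumes "f holomorphic_on UNIV" "\<And>z. (cmod z - b) * cmod (f z) \<le> M"
  shows "f z = 0"
proof (rule Liouville_weak_0[OF assms(1)])
  have "eventually (\<lambda>z. cmod (f z) \<le> M / (cmod z - b)) at_infinity"
    unfolding eventually_at_infinity
  proof (intro exI allI impI)
    fix z :: complex assume "b + 1 \<le> cmod z"
    thus "cmod (f z) \<le> M / (cmod z - b)" using assms(2)[of z] by (simp add: field_simps)
  qed
  moreover have "((\<lambda>z::complex. M / (cmod z - b)) \<longlongrightarrow> 0) at_infinity"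
  proof (rule tendsto_divide_0[OF tendsto_const])
    have "filterlim (\<lambda>z::complex. - b + cmod z) at_top at_infinity"
      by (intro filterlim_tendsto_add_at_top[OF tendsto_const] filterlim_norm_at_top)
    thus "filterlim (\<lambda>z::complex. cmod z - b) at_infinity at_infinity"
      by (intro filterlim_at_top_imp_at_infinity) simp
  qed
  ultimately show "(f \<longlongrightarrow> 0) at_infinity" by (rule Lim_null_comparison)
qed

text \<open>Applying \<open>B Z\<close> to \<open>(z Q - I) R z x = x\<close> gives
  \<open>z w - B w = B Z x\<close> for \<open>w = Z (R z x)\<close>, so w decays like
  \<open>1/|z|\<close>. Liouville then kills its value at 0, which is \<open>- Z x\<close> because
  \<open>R 0 = -I\<close>.\<close>

lemma quasinilpotent_intertwine_right:
  assumes Q: "quasinilpotent Q" "Q \<in> cblinops" and "Z \<in> cblinops" "B \<in> cblinops"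
    and Z: "Z = B o\<^sub>L Z o\<^sub>L Q"
  shows "Z = 0"
proof (rule blinfun_eqI)
  fix x
  obtain R where R: "is_resolvent Q R" by (rule quasinilpotent_resolvent[OF Q])
  \<comment> \<open>Testing against the value at 0 makes \<open>f 0\<close> the squared norm of that
    value.\<close>
  define v where "v = Z (R 0 x)"
  define f where "f = (\<lambda>z. cinner (Z (R z x)) v)"
  have "f 0 = 0"
  proof (rule Liouville_decay[where f = f and b = "norm B" and M = "norm (B (Z x)) * norm v"])
    show "f holomorphic_on UNIV" unfolding f_def by (rule resolvent_holomorphic[OF R Q(2) assms(3)])
    fix z
    define w where "w = Z (R z x)"
    have "B (Z x) = B (Z (z *\<^sub>C Q (R z x) - R z x))" by (simp only: is_resolventD(3)[OF R])
    also have "\<dots> = z *\<^sub>C B (Z (Q (R z x))) - B (Z (R z x))"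
      by (simp add: blinfun.diff_right cblinops_scaleC assms(3,4))
    also have "B (Z (Q (R z x))) = w" using Z by (metis blinfun_apply_blinfun_compose w_def)
    finally have "B (Z x) = z *\<^sub>C w - B w" by (simp add: w_def)
    hence "cmod z * norm w - norm (B w) \<le> norm (B (Z x))"
      using norm_triangle_ineq2[of "z *\<^sub>C w" "B w"] by (simp add: norm_scaleC)
    hence *: "(cmod z - norm B) * norm w \<le> norm (B (Z x))"
      using norm_blinfun[of B w] by (simp add: algebra_simps)
    show "(cmod z - norm B) * cmod (f z) \<le> norm (B (Z x)) * norm v"
    proof (cases "cmod z \<ge> norm B")
      case True
      hence "(cmod z - norm B) * cmod (f z) \<le> (cmod z - norm B) * (norm w * norm v)"
        unfolding f_def w_def by (intro mult_left_mono Cauchy_Schwarz) auto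
      also have "\<dots> \<le> norm (B (Z x)) * norm v"
        using mult_right_mono[OF *, of "norm v"] by (simp add: mult.assoc)
      finally show ?thesis .
    next
      case False
      hence "(cmod z - norm B) * cmod (f z) \<le> 0" by (intro mult_nonpos_nonneg) auto
      also have "0 \<le> norm (B (Z x)) * norm v" by simp
      finally show ?thesis .
    qed
  qed
  hence "Z (R 0 x) = 0" by (simp add: f_def v_def cinner_self_eq_0_iff)
  moreover have "0 *\<^sub>C Q (R 0 x) - R 0 x = x" by (rule is_resolventD[OF R])
  hence "R 0 x = - x" by (metis complex_vector.scale_zero_left diff_0 minus_minus)
  ultimately show "Z x = blinfun_apply 0 x" by (simp add: blinfun.minus_right)
qed

text \<open>B now acts before Z, so the estimate does not close on a single vector; instead
  \<open>F = R z Z\<close> satisfies \<open>z F = F B + Z B\<close>, which bounds its operator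
  norm.\<close>

lemma quasinilpotent_intertwine_left:
  assumes Q: "quasinilpotent Q" "Q \<in> cblinops" and "Z \<in> cblinops" "B \<in> cblinops"
    and Z: "Z = Q o\<^sub>L Z o\<^sub>L B"
  shows "Z = 0"
proof (rule blinfun_eqI)
  fix x
  obtain R where R: "is_resolvent Q R" by (rule quasinilpotent_resolvent[OF Q])
  define v where "v = R 0 (Z x)"
  define f where "f = (\<lambda>z. cinner (R z (Z x)) v)"
  define C where "C = norm x * norm v"
  have C: "C \<ge> 0" by (simp add: C_def)
  have "f 0 = 0"
  proof (rule Liouville_decay[where f = f and b = "norm B" and M = "norm (Z o\<^sub>L B) * C"])
    show "f holomorphic_on UNIV"
      using resolvent_holomorphic[OF R Q(2) cblinops_id] by (simp add: f_def)
    fix z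
    define F where "F = R z o\<^sub>L Z"
    have "z *\<^sub>C F y = F (B y) + Z (B y)" for y
    proof -
      have "Z (B y) = R z (z *\<^sub>C Q (Z (B y)) - Z (B y))" by (simp only: is_resolventD(2)[OF R])
      also have "Q (Z (B y)) = Z y" using Z by (metis blinfun_apply_blinfun_compose)
      also have "R z (z *\<^sub>C Z y - Z (B y)) = z *\<^sub>C F y - F (B y)"
        by (simp add: blinfun.diff_right cblinops_scaleC[OF is_resolventD(1)[OF R]] F_def)
      finally show ?thesis by simp
    qed
    hence eq: "scaling z o\<^sub>L F = (F o\<^sub>L B) + (Z o\<^sub>L B)"
      by (intro blinfun_eqI) (simp add: scaling_apply blinfun.add_left)
    have "cmod z * norm F \<le> norm F * norm B + norm (Z o\<^sub>L B)"
    proof (cases "z = 0")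
      case False
      have "norm F \<le> norm (scaling z o\<^sub>L F) / cmod z"
      proof (rule norm_blinfun_bound)
        fix y
        have "cmod z * norm (F y) \<le> norm (scaling z o\<^sub>L F) * norm y"
          using norm_blinfun[of "scaling z o\<^sub>L F" y] by (simp add: scaling_apply norm_scaleC)
        thus "norm (F y) \<le> norm (scaling z o\<^sub>L F) / cmod z * norm y"
          using False by (simp add: field_simps)
      qed simp
      hence "cmod z * norm F \<le> norm (scaling z o\<^sub>L F)" using False by (simp add: field_simps)
      also have "\<dots> \<le> norm (F o\<^sub>L B) + norm (Z o\<^sub>L B)" unfolding eq by (rule norm_triangle_ineq)
      also have "norm (F o\<^sub>L B) \<le> norm F * norm B" by (rule norm_blinfun_compose)
      finally show ?thesis by simp
    qed simp
    hence *: "(cmod z - norm B) * norm F \<le> norm (Z o\<^sub>L B)" by (simp add: algebra_simps)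
    have "cmod (f z) \<le> norm (F x) * norm v" by (simp add: f_def F_def Cauchy_Schwarz)
    also have "\<dots> \<le> norm F * C"
      unfolding C_def mult.assoc[symmetric] by (intro mult_right_mono norm_blinfun) auto
    finally have **: "cmod (f z) \<le> norm F * C" .
    show "(cmod z - norm B) * cmod (f z) \<le> norm (Z o\<^sub>L B) * C"
    proof (cases "cmod z \<ge> norm B")
      case True
      hence "(cmod z - norm B) * cmod (f z) \<le> (cmod z - norm B) * (norm F * C)"
        using ** by (intro mult_left_mono) auto
      also have "\<dots> \<le> norm (Z o\<^sub>L B) * C"
        using mult_right_mono[OF * C] by (simp add: mult.assoc)
      finally show ?thesis .
    next
      case False
      hence "(cmod z - norm B) * cmod (f z) \<le> 0" by (intro mult_nonpos_nonneg) auto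
      also have "0 \<le> norm (Z o\<^sub>L B) * C" using C by simp
      finally show ?thesis .
    qed
  qed
  hence "R 0 (Z x) = 0" by (simp add: f_def v_def cinner_self_eq_0_iff)
  moreover have "R 0 (0 *\<^sub>C Q (Z x) - Z x) = Z x" by (rule is_resolventD[OF R])
  ultimately show "Z x = blinfun_apply 0 x" by (simp add: blinfun.minus_right)
qed

section \<open>Quasinilpotent operators\<close>

lemma not_in_cspectrumI:
  fixes S T :: "'a::chilbert_space \<Rightarrow>\<^sub>L 'a"
  assumes "S \<in> cblinops" "\<And>x. S (c *\<^sub>C x - T x) = x" "\<And>x. c *\<^sub>C S x - T (S x) = x"
  shows "c \<notin> cspectrum T"
  using assms unfolding cspectrum_def by blast

lemma not_in_cspectrumE:
  fixes T :: "'a::chilbert_space \<Rightarrow>\<^sub>L 'a"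
  assumes "c \<notin> cspectrum T"
  obtains S :: "'a \<Rightarrow>\<^sub>L 'a" where "S \<in> cblinops" "\<And>x. S (c *\<^sub>C x - T x) = x" "\<And>x. c *\<^sub>C S x - T (S x) = x"
  using assms unfolding cspectrum_def by blast

lemma zero_not_in_cspectrum_iff:
  "0 \<notin> cspectrum T \<longleftrightarrow> (\<exists>S\<in>cblinops. (\<forall>x. S (T x) = x) \<and> (\<forall>x. T (S x) = x))"
proof
  assume "0 \<notin> cspectrum T"
  then obtain S where "S \<in> cblinops" "\<And>x. S (0 *\<^sub>C x - T x) = x" "\<And>x. 0 *\<^sub>C S x - T (S x) = x"
    using not_in_cspectrumE by blast
  thus "\<exists>S\<in>cblinops. (\<forall>x. S (T x) = x) \<and> (\<forall>x. T (S x) = x)"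
    by (intro bexI[of _ "- S"]) (auto simp: blinfun.minus_left blinfun.minus_right cblinops_def)
next
  assume "\<exists>S\<in>cblinops. (\<forall>x. S (T x) = x) \<and> (\<forall>x. T (S x) = x)"
  then obtain S where "S \<in> cblinops" "\<And>x. S (T x) = x" "\<And>x. T (S x) = x" by blast
  thus "0 \<notin> cspectrum T"
    by (intro not_in_cspectrumI[of "- S"])
      (auto simp: blinfun.minus_left blinfun.minus_right cblinops_def)
qed

text \<open>The non-zero vector matters: on the trivial space the spectrum is empty, not
  {0}.\<close>

lemma quasinilpotent_zero:
  assumes "(x :: 'a::chilbert_space) \<noteq> 0"
  shows "quasinilpotent (0 :: 'a \<Rightarrow>\<^sub>L 'a)"
proof -
  have "0 \<in> cspectrum (0 :: 'a \<Rightarrow>\<^sub>L 'a)"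
    using assms zero_not_in_cspectrum_iff[of "0 :: 'a \<Rightarrow>\<^sub>L 'a"] by auto
  moreover have "c \<notin> cspectrum (0 :: 'a \<Rightarrow>\<^sub>L 'a)" if "c \<noteq> 0" for c
    using that by (intro not_in_cspectrumI[of "scaling (inverse c)"])
      (auto simp: cblinops_scaling scaling_apply scaleC_scaleC scaleC_one)
  ultimately show ?thesis unfolding quasinilpotent_def by blast
qed

text \<open>Away from 0, a square root s of c factors \<open>c I - N^2\<close> through
  \<open>s I - N\<close> and \<open>-s I - N\<close>, both invertible. At 0, an inverse S of
  \<open>N^2\<close> commutes with N, so \<open>S N\<close> would invert N.\<close>

lemma quasinilpotent_square:
  assumes N: "quasinilpotent N" "N \<in> cblinops"
  shows "quasinilpotent (N o\<^sub>L N)"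
proof -
  have "0 \<in> cspectrum (N o\<^sub>L N)"
  proof (rule ccontr)
    assume "0 \<notin> cspectrum (N o\<^sub>L N)"
    then obtain S where S: "S \<in> cblinops" "\<And>x. S (N (N x)) = x" "\<And>x. N (N (S x)) = x"
      by (auto simp: zero_not_in_cspectrum_iff)
    have comm: "S (N x) = N (S x)" for x
      by (metis S(2,3))
    have "0 \<notin> cspectrum N"
      unfolding zero_not_in_cspectrum_iff
      by (intro bexI[of _ "S o\<^sub>L N"]) (auto simp: S comm cblinops_compose N)
    thus False using N by (simp add: quasinilpotent_def)
  qed
  moreover have "c \<notin> cspectrum (N o\<^sub>L N)" if "c \<noteq> 0" for c
  proof -
    define s where "s = csqrt c"
    have s: "s * s = c" "s \<noteq> 0"
      using that by (auto simp: s_def power2_eq_square[symmetric])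
    obtain S where S: "S \<in> cblinops" "\<And>x. S (s *\<^sub>C x - N x) = x" "\<And>x. s *\<^sub>C S x - N (S x) = x"
      by (rule not_in_cspectrumE[of s N]) (use N s in \<open>auto simp: quasinilpotent_def\<close>)
    obtain T where T: "T \<in> cblinops" "\<And>x. T ((- s) *\<^sub>C x - N x) = x" "\<And>x. (- s) *\<^sub>C T x - N (T x) = x"
      by (rule not_in_cspectrumE[of "- s" N]) (use N s in \<open>auto simp: quasinilpotent_def\<close>)
    have factor: "c *\<^sub>C x - N (N x) = - ((- s) *\<^sub>C (s *\<^sub>C x - N x) - N (s *\<^sub>C x - N x))" for x
      by (simp add: cblinops_scaleC[OF N(2)] complex_vector.scale_right_diff_distrib
          blinfun.diff_right scaleC_scaleC s)
    show ?thesis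
    proof (rule not_in_cspectrumI)
      show "- (S o\<^sub>L T) \<in> cblinops"
        using S(1) T(1) by (simp add: cblinops_def blinfun.minus_left)
      fix x
      show "(- (S o\<^sub>L T)) (c *\<^sub>C x - (N o\<^sub>L N) x) = x"
        by (simp only: blinfun_apply_blinfun_compose blinfun.minus_left factor blinfun.minus_right
            T(2) S(2) minus_minus)
      have "c *\<^sub>C S (T x) - N (N (S (T x))) = - ((- s) *\<^sub>C T x - N (T x))"
        by (simp only: factor S(3))
      thus "c *\<^sub>C (- (S o\<^sub>L T)) x - (N o\<^sub>L N) ((- (S o\<^sub>L T)) x) = x"
        by (simp only: T(3) blinfun.minus_left blinfun.minus_right blinfun_apply_blinfun_compose
            complex_vector.scale_minus_right minus_diff_minus minus_minus)
    qed
  qed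
  ultimately show ?thesis unfolding quasinilpotent_def by blast
qed

text \<open>If \<open>W C\<close> were invertible with inverse \<open>S\<close>, then \<open>W = S W (C W)\<close> would force \<open>W = 0\<close>.\<close>

lemma quasinilpotent_swap:
  assumes CW: "quasinilpotent (C o\<^sub>L W)" and C: "C \<in> cblinops" and W: "W \<in> cblinops" "W \<noteq> 0"
  shows "quasinilpotent (W o\<^sub>L C)"
proof -
  have "0 \<in> cspectrum (W o\<^sub>L C)"
  proof (rule ccontr)
    assume "0 \<notin> cspectrum (W o\<^sub>L C)"
    then obtain S where S: "S \<in> cblinops" "\<And>x. S (W (C x)) = x"
      by (auto simp: zero_not_in_cspectrum_iff)
    have "W = S o\<^sub>L W o\<^sub>L (C o\<^sub>L W)" by (rule blinfun_eqI) (simp add: S)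
    hence "W = 0"
      by (rule quasinilpotent_intertwine_right[OF CW cblinops_compose[OF C W(1)] W(1) S(1)])
    thus False using W(2) by simp
  qed
  moreover have "c \<notin> cspectrum (W o\<^sub>L C)" if c: "c \<noteq> 0" for c
  proof -
    obtain S where S: "S \<in> cblinops" "\<And>x. S (c *\<^sub>C x - (C o\<^sub>L W) x) = x"
        "\<And>x. c *\<^sub>C S x - (C o\<^sub>L W) (S x) = x"
      by (rule not_in_cspectrumE[of c "C o\<^sub>L W"]) (use CW c in \<open>auto simp: quasinilpotent_def\<close>)
    \<comment> \<open>Jacobson's formula: as S inverts \<open>c I - C W\<close>, the operator
      \<open>c^-1 (I + W S C)\<close> inverts \<open>c I - W C\<close>.\<close>
    define T where "T = scaling (inverse c) o\<^sub>L (id_blinfun + (W o\<^sub>L S o\<^sub>L C))"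
    have T: "T x = inverse c *\<^sub>C (x + W (S (C x)))" for x
      by (simp add: T_def scaling_apply blinfun.add_left)
    show ?thesis
    proof (rule not_in_cspectrumI)
      show "T \<in> cblinops"
        unfolding T_def by (intro cblinops_compose cblinops_scaling cblinops_add cblinops_id S C W)
      fix x
      have "S (C (c *\<^sub>C x - W (C x))) = C x"
        using S(2)[of "C x"] by (simp add: blinfun.diff_right cblinops_scaleC C)
      thus "T (c *\<^sub>C x - (W o\<^sub>L C) x) = x"
        using that by (simp add: T scaleC_scaleC scaleC_one)
      have "c *\<^sub>C (x + W (S (C x))) - W (C (x + W (S (C x)))) =
          c *\<^sub>C x + W (c *\<^sub>C S (C x) - C (W (S (C x)))) - W (C x)"
        by (simp add: scaleC_add_right blinfun.add_right blinfun.diff_right cblinops_scaleC W)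
      also have "c *\<^sub>C S (C x) - C (W (S (C x))) = C x" using S(3)[of "C x"] by simp
      finally have *: "c *\<^sub>C (x + W (S (C x))) - W (C (x + W (S (C x)))) = c *\<^sub>C x" by simp
      have "c *\<^sub>C T x - W (C (T x)) =
          inverse c *\<^sub>C (c *\<^sub>C (x + W (S (C x))) - W (C (x + W (S (C x)))))"
        by (simp only: T cblinops_scaleC[OF C] cblinops_scaleC[OF W(1)]
            complex_vector.scale_right_diff_distrib scaleC_scaleC mult.commute)
      thus "c *\<^sub>C T x - (W o\<^sub>L C) (T x) = x"
        using that by (simp add: * scaleC_scaleC scaleC_one)
    qed
  qed
  ultimately show ?thesis unfolding quasinilpotent_def by blast
qed

section \<open>Uniqueness of generalized inverses\<close>

text \<open>The idempotents \<open>T S\<close> and \<open>T S'\<close> absorb each other on both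
  sides, hence coincide, and \<open>S T S = S\<close> then determines S.\<close>

lemma gdrazin_inverse_eqI:
  assumes T: "T \<in> cblinops" and S: "is_gdrazin_inverse T S"
  shows "gdrazin_inverse T = S"
  unfolding gdrazin_inverse_def
proof (rule the_equality)
  fix S' assume S': "is_gdrazin_inverse T S'"
  have absorb: "T (S1 (T (S2 x))) = T (S1 x)" "T (S2 (T (S1 x))) = T (S1 x)"
    if S1: "is_gdrazin_inverse T S1" and S2: "is_gdrazin_inverse T S2" for S1 S2 x
  proof -
    have 1: "S1 \<in> cblinops" "S1 (T x) = T (S1 x)" "T (S1 (S1 x)) = S1 x" for x
      using S1 unfolding is_gdrazin_inverse_def by (metis blinfun_apply_blinfun_compose)+
    have 2: "S2 \<in> cblinops" "S2 (T x) = T (S2 x)" "T (S2 (S2 x)) = S2 x" for x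
      using S2 unfolding is_gdrazin_inverse_def by (metis blinfun_apply_blinfun_compose)+
    have 3: "T (S1 (S2 (S2 x))) = S1 (S2 x)" "T (S2 (S1 (S1 x))) = S2 (S1 x)" for x
      by (metis 1(2) 2(3)) (metis 2(2) 1(3))
    \<comment> \<open>\<open>N = T (I - T S2)\<close>. The defects \<open>T S1 (I - T S2)\<close>
      and \<open>(I - T S2) T S1\<close> satisfy \<open>Z = S1 Z N\<close> and
      \<open>Z = N Z S1\<close> respectively, so both vanish.\<close>
    define N where "N = T - (T o\<^sub>L T o\<^sub>L S2)"
    have N: "quasinilpotent N" "N \<in> cblinops"
      using S2 T 2(1) by (auto simp: N_def is_gdrazin_inverse_def intro!: cblinops_diff cblinops_compose)
    have cb: "(T o\<^sub>L S1) - (T o\<^sub>L S1 o\<^sub>L T o\<^sub>L S2) \<in> cblinops"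
        "(T o\<^sub>L S1) - (T o\<^sub>L S2 o\<^sub>L T o\<^sub>L S1) \<in> cblinops"
      by (intro cblinops_diff cblinops_compose T 1(1) 2(1))+
    have "(T o\<^sub>L S1) - (T o\<^sub>L S1 o\<^sub>L T o\<^sub>L S2) = 0"
      by (rule quasinilpotent_intertwine_right[OF N cb(1) 1(1)], rule blinfun_eqI)
        (simp add: N_def blinfun.diff_left blinfun.diff_right 1(2,3) 2(2,3) 3)
    from arg_cong[OF this, of "\<lambda>F. blinfun_apply F x"]
    show "T (S1 (T (S2 x))) = T (S1 x)" by (simp add: blinfun.diff_left)
    have "(T o\<^sub>L S1) - (T o\<^sub>L S2 o\<^sub>L T o\<^sub>L S1) = 0"
      by (rule quasinilpotent_intertwine_left[OF N cb(2) 1(1)], rule blinfun_eqI)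
        (simp add: N_def blinfun.diff_left blinfun.diff_right 1(2,3) 2(2,3) 3)
    from arg_cong[OF this, of "\<lambda>F. blinfun_apply F x"]
    show "T (S2 (T (S1 x))) = T (S1 x)" by (simp add: blinfun.diff_left)
  qed
  have eq: "T (S' x) = T (S x)" for x
    using absorb[OF S S'] absorb[OF S' S] by metis
  have "T (R x) = R (T x)" "R (R (T x)) = R x" if "is_gdrazin_inverse T R" for R x
    using that unfolding is_gdrazin_inverse_def by (metis blinfun_apply_blinfun_compose)+
  from this[OF S] this[OF S'] show "S' = S"
    by (intro blinfun_eqI) (metis eq)
qed (rule S)

text \<open>From \<open>T S' = (T S)(T S')\<close>, self-adjointness of both factors gives
  \<open>T S' = (T S')(T S) = T S\<close>; symmetrically \<open>S' T = S T\<close>. Then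
  \<open>S' = S' T S' = S T S = S\<close>.\<close>

lemma mp_inverse_eqI:
  assumes S: "is_mp_inverse T S"
  shows "mp_inverse T = S"
  unfolding mp_inverse_def
proof (rule the_equality)
  fix S' assume S': "is_mp_inverse T S'"
  have eqs: "T (S1 (T x)) = T x" "S1 (T (S1 y)) = S1 y"
    "cinner (T (S1 y)) y' = cinner y (T (S1 y'))" "cinner (S1 (T x)) x' = cinner x (S1 (T x'))"
    if "is_mp_inverse T S1" for S1 x x' y y'
    using that unfolding is_mp_inverse_def self_adjoint_def
    by (metis blinfun_apply_blinfun_compose)+
  note 1 = eqs[OF S] and 2 = eqs[OF S']
  have "T (S' y) = T (S y)" for y
  proof (rule cinner_left_ext)
    fix v
    have "cinner (T (S' y)) v = cinner (T (S (T (S' y)))) v" by (simp add: 1)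
    also have "\<dots> = cinner y (T (S' (T (S v))))" by (simp only: 1(3) 2(3))
    also have "\<dots> = cinner (T (S y)) v" by (simp only: 2(1) 1(3))
    finally show "cinner (T (S' y)) v = cinner (T (S y)) v" .
  qed
  moreover have "S' (T x) = S (T x)" for x
  proof (rule cinner_left_ext)
    fix v
    have "cinner (S' (T x)) v = cinner (S' (T (S (T x)))) v" by (simp add: 1)
    also have "\<dots> = cinner x (S (T (S' (T v))))" by (simp only: 1(4) 2(4))
    also have "\<dots> = cinner (S (T x)) v" by (simp only: 2(1) 1(4))
    finally show "cinner (S' (T x)) v = cinner (S (T x)) v" .
  qed
  ultimately show "S' = S" by (intro blinfun_eqI) (metis 1(2) 2(2))
qed (rule S)

text \<open>\<open>S T\<close> is an idempotent with the range of S, so that range is the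
  fixed-point set of a bounded operator. Hence ranges of Drazin inverses admit orthogonal
  projectors.\<close>

lemma Ran_outer_inverse:
  assumes "S \<in> cblinops" "S o\<^sub>L T o\<^sub>L S = S"
  shows "x \<in> Ran S \<longleftrightarrow> S (T x) = x" "closed (Ran S)" "complex_vector.subspace (Ran S)"
proof -
  have iff: "x \<in> Ran S \<longleftrightarrow> S (T x) = x" for x
    using assms(2) by (metis (mono_tags, lifting) Ran_def blinfun_apply_blinfun_compose rangeE rangeI)
  show "x \<in> Ran S \<longleftrightarrow> S (T x) = x" by (rule iff)
  have "Ran S = {x. S (T x) = x}" using iff by blast
  moreover have "closed {x. S (T x) = x}"
    by (intro closed_Collect_eq continuous_intros)
  ultimately show "closed (Ran S)" by simp
  show "complex_vector.subspace (Ran S)"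
  proof (rule complex_vector.subspaceI)
    show "0 \<in> Ran S" by (simp add: iff)
    fix x y assume "x \<in> Ran S" "y \<in> Ran S"
    thus "x + y \<in> Ran S" by (simp add: iff blinfun.add_right)
  next
    fix c x assume "x \<in> Ran S"
    then obtain y where "x = S y" by (auto simp: Ran_def)
    hence "c *\<^sub>C x = S (c *\<^sub>C y)" by (simp add: cblinops_scaleC assms)
    thus "c *\<^sub>C x \<in> Ran S" by (simp add: Ran_def)
  qed
qed

text \<open>\<open>S T\<close> is the identity on \<open>R(S)\<close>, so an operator B with range
  in \<open>R(S)\<close> is recovered from \<open>T B\<close> as \<open>S (T B)\<close>.\<close>

lemma core_ep_inverse_eq:
  assumes T: "T \<in> cblinops" and S: "is_gdrazin_inverse T S"
  shows "core_ep_inverse T = S o\<^sub>L orth_proj (Ran S)"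
proof -
  have cb: "S \<in> cblinops" and outer: "S o\<^sub>L T o\<^sub>L S = S"
    and comm: "T (S x) = S (T x)" for x
    using S unfolding is_gdrazin_inverse_def by (metis blinfun_apply_blinfun_compose)+
  note ran = Ran_outer_inverse[OF cb outer]
  define Q where "Q = orth_proj (Ran S)"
  note Q = orth_proj_properties[OF ran(2,3), folded Q_def]
  have SQ: "S (T (Q x)) = Q x" for x
    using Q(2) ran(1) by (metis Ran_def rangeI)
  show ?thesis
    unfolding core_ep_inverse_def gdrazin_inverse_eqI[OF T S] Q_def[symmetric]
  proof (rule the_equality)
    have "T o\<^sub>L (S o\<^sub>L Q) = Q" by (rule blinfun_eqI) (simp add: comm SQ)
    moreover have "Ran (S o\<^sub>L Q) \<subseteq> Ran S" by (auto simp: Ran_def)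
    ultimately show "S o\<^sub>L Q \<in> cblinops \<and> T o\<^sub>L (S o\<^sub>L Q) = Q \<and> Ran (S o\<^sub>L Q) \<subseteq> Ran S"
      using cb Q(1) by (simp add: cblinops_compose)
  next
    fix B assume B: "B \<in> cblinops \<and> T o\<^sub>L B = Q \<and> Ran B \<subseteq> Ran S"
    show "B = S o\<^sub>L Q"
    proof (rule blinfun_eqI)
      fix x
      have "B x \<in> Ran S" using B by (auto simp: Ran_def)
      hence "B x = S (T (B x))" using ran(1) by simp
      also have "T (B x) = Q x" using B by (metis blinfun_apply_blinfun_compose)
      finally show "B x = (S o\<^sub>L Q) x" by simp
    qed
  qed
qed

text \<open>The remainder \<open>T - T^2 S\<close> is the zero operator; the vector x serves
  \<open>quasinilpotent_zero\<close>.\<close>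

lemma group_inverseI:
  fixes T :: "'a::chilbert_space \<Rightarrow>\<^sub>L 'a"
  assumes "(x :: 'a) \<noteq> 0" "T \<in> cblinops" "S \<in> cblinops"
    "T o\<^sub>L S = S o\<^sub>L T" "S o\<^sub>L T o\<^sub>L S = S" "T o\<^sub>L T o\<^sub>L S = T"
  shows "is_gdrazin_inverse T S" "group_invertible T" "group_inverse T = S"
proof -
  show S: "is_gdrazin_inverse T S"
    using assms quasinilpotent_zero[OF assms(1)] by (simp add: is_gdrazin_inverse_def)
  show "group_inverse T = S"
    unfolding group_inverse_def by (rule gdrazin_inverse_eqI[OF assms(2) S])
  thus "group_invertible T"
    using S assms by (auto simp: group_invertible_def gdrazin_invertible_def group_inverse_def)
qed

text \<open>\<open>T S\<close> is an idempotent commuting with T, so the remainder of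
  \<open>T^2\<close> is the square of that of T; \<open>S = S^2 T\<close> preserves the
  range.\<close>

lemma is_gdrazin_inverse_square:
  assumes T: "T \<in> cblinops" and S: "is_gdrazin_inverse T S"
  shows "is_gdrazin_inverse (T o\<^sub>L T) (S o\<^sub>L S)" "Ran (S o\<^sub>L S) = Ran S"
proof -
  have cb: "S \<in> cblinops" and comm: "T (S x) = S (T x)" and outer: "S (S (T x)) = S x" for x
    using S unfolding is_gdrazin_inverse_def by (metis blinfun_apply_blinfun_compose)+
  define N where "N = T - (T o\<^sub>L T o\<^sub>L S)"
  have N: "quasinilpotent N" "N \<in> cblinops"
    using S T cb by (auto simp: N_def is_gdrazin_inverse_def intro!: cblinops_diff cblinops_compose)
  have "N o\<^sub>L N = (T o\<^sub>L T) - ((T o\<^sub>L T) o\<^sub>L (T o\<^sub>L T) o\<^sub>L (S o\<^sub>L S))"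
    by (rule blinfun_eqI) (simp add: N_def blinfun.diff_left blinfun.diff_right comm outer)
  with quasinilpotent_square[OF N]
  have "quasinilpotent ((T o\<^sub>L T) - ((T o\<^sub>L T) o\<^sub>L (T o\<^sub>L T) o\<^sub>L (S o\<^sub>L S)))" by simp
  thus "is_gdrazin_inverse (T o\<^sub>L T) (S o\<^sub>L S)"
    using cb by (auto simp: is_gdrazin_inverse_def cblinops_compose comm outer intro!: blinfun_eqI)
  have "S x = S (S (T x))" for x by (simp add: outer)
  thus "Ran (S o\<^sub>L S) = Ran S" by (auto simp: Ran_def)
qed

section \<open>Weighted generalized Drazin invertible operators\<close>

text \<open>Fixing a witness B postpones its uniqueness, which is proved by interpreting the locale
  a second time.\<close>

locale wgdrazin =
  fixes W :: "'y::chilbert_space \<Rightarrow>\<^sub>L 'x::chilbert_space"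
    and A B :: "'x \<Rightarrow>\<^sub>L 'y"
  assumes W_cb: "W \<in> cblinops" and W_nz: "W \<noteq> 0" and A_cb: "A \<in> cblinops"
    and B: "is_wgdrazin_inverse W A B"
begin

section \<open>Generalized Drazin inverses of \<open>A W\<close> and \<open>W A\<close>\<close>

lemma B_cb: "B \<in> cblinops"
  using B by (simp add: is_wgdrazin_inverse_def)

lemma comm: "A (W (B x)) = B (W (A x))"
  using B unfolding is_wgdrazin_inverse_def by (metis blinfun_apply_blinfun_compose)

text \<open>\<open>B W A W B = B\<close> is reshaped by \<open>comm\<close> so that both rewrite
  rules move A to the right.\<close>

lemma outer: "B (W (B (W (A x)))) = B x"
  using B comm unfolding is_wgdrazin_inverse_def by (metis blinfun_apply_blinfun_compose)

lemma gdrazin_AW: "is_gdrazin_inverse (A o\<^sub>L W) (B o\<^sub>L W)"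
proof -
  have "quasinilpotent ((A - (A o\<^sub>L W o\<^sub>L B o\<^sub>L W o\<^sub>L A)) o\<^sub>L W)"
    using B unfolding is_wgdrazin_inverse_def by blast
  also have "(A - (A o\<^sub>L W o\<^sub>L B o\<^sub>L W o\<^sub>L A)) o\<^sub>L W =
      (A o\<^sub>L W) - ((A o\<^sub>L W) o\<^sub>L (A o\<^sub>L W) o\<^sub>L (B o\<^sub>L W))"
    by (rule blinfun_eqI) (simp add: blinfun.diff_left blinfun.diff_right comm)
  finally show ?thesis
    using B_cb W_cb by (auto simp: is_gdrazin_inverse_def
        cblinops_compose comm outer intro!: blinfun_eqI)
qed

text \<open>Weighted quasinilpotence concerns Y only; \<open>quasinilpotent_swap\<close> carries it
  from \<open>C W\<close> to \<open>W C\<close>, the remainder of \<open>W A\<close>.\<close>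

lemma gdrazin_WA: "is_gdrazin_inverse (W o\<^sub>L A) (W o\<^sub>L B)"
proof -
  define C where "C = A - (A o\<^sub>L W o\<^sub>L B o\<^sub>L W o\<^sub>L A)"
  have "C \<in> cblinops"
    unfolding C_def by (intro cblinops_diff cblinops_compose A_cb W_cb B_cb)
  moreover have "quasinilpotent (C o\<^sub>L W)"
    using B unfolding is_wgdrazin_inverse_def C_def by blast
  ultimately have "quasinilpotent (W o\<^sub>L C)"
    using quasinilpotent_swap W_cb W_nz by blast
  moreover have "W o\<^sub>L C = (W o\<^sub>L A) - ((W o\<^sub>L A) o\<^sub>L (W o\<^sub>L A) o\<^sub>L (W o\<^sub>L B))"
    by (rule blinfun_eqI) (simp add: C_def blinfun.diff_left blinfun.diff_right comm)
  ultimately show ?thesis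
    using B_cb W_cb by (auto simp: is_gdrazin_inverse_def
        cblinops_compose comm outer intro!: blinfun_eqI)
qed

lemmas gdrazin_inverse_AW = gdrazin_inverse_eqI[OF cblinops_compose[OF A_cb W_cb] gdrazin_AW]
lemmas gdrazin_inverse_WA = gdrazin_inverse_eqI[OF cblinops_compose[OF W_cb A_cb] gdrazin_WA]

section \<open>Orthogonal projectors onto \<open>R((AW)^d)\<close> and
  \<open>R((WA)^d)\<close>\<close>

definition P where "P = orth_proj (Ran (B o\<^sub>L W))"
definition Q where "Q = orth_proj (Ran (W o\<^sub>L B))"

text \<open>\<open>R(B W)\<close> is the fixed space of \<open>B W A W\<close>, and contains
  \<open>R(B)\<close> since \<open>B = B W A W B\<close>.\<close>

lemma P_sa: "self_adjoint P"
  and P_B: "P (B x) = B x" and BWAWP: "B (W (A (W (P y)))) = P y"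
proof -
  have cb: "B o\<^sub>L W \<in> cblinops" and o: "(B o\<^sub>L W) o\<^sub>L (A o\<^sub>L W) o\<^sub>L (B o\<^sub>L W) = B o\<^sub>L W"
    using gdrazin_AW by (auto simp: is_gdrazin_inverse_def)
  note ran = Ran_outer_inverse[OF cb o]
  note P = orth_proj_properties[OF ran(2,3), folded P_def]
  show "self_adjoint P" by (rule P(3))
  have "B x \<in> Ran (B o\<^sub>L W)" by (simp add: ran(1) comm outer)
  thus "P (B x) = B x" by (rule P(4))
  have "P y \<in> Ran (B o\<^sub>L W)" using P(2) by (metis Ran_def rangeI)
  thus "B (W (A (W (P y)))) = P y" by (simp add: ran(1))
qed

lemma Q_cb: "Q \<in> cblinops" and Q_sa: "self_adjoint Q"
  and Q_WB: "Q (W (B x)) = W (B x)" and WBWAQ: "W (B (W (A (Q x)))) = Q x"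
proof -
  have cb: "W o\<^sub>L B \<in> cblinops" and o: "(W o\<^sub>L B) o\<^sub>L (W o\<^sub>L A) o\<^sub>L (W o\<^sub>L B) = W o\<^sub>L B"
    using gdrazin_WA by (auto simp: is_gdrazin_inverse_def)
  note ran = Ran_outer_inverse[OF cb o]
  note Q = orth_proj_properties[OF ran(2,3), folded Q_def]
  show "Q \<in> cblinops" "self_adjoint Q" by (rule Q)+
  have "W (B x) \<in> Ran (W o\<^sub>L B)" by (simp add: Ran_def)
  thus "Q (W (B x)) = W (B x)" by (rule Q(4))
  have "Q x \<in> Ran (W o\<^sub>L B)" using Q(2) by (metis Ran_def rangeI)
  thus "W (B (W (A (Q x)))) = Q x" by (simp add: ran(1))
qed

lemma Q_idem: "Q (Q x) = Q x"
  by (metis WBWAQ Q_WB)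

lemma Q_WP: "Q (W (P y)) = W (P y)"
  by (metis BWAWP Q_WB)

text \<open>\<open>R((WA)^d)\<close> is invariant under \<open>W A\<close>, which commutes with
  \<open>W B\<close>.\<close>

lemma Q_WAQ: "Q (W (A (Q x))) = W (A (Q x))"
  by (metis WBWAQ Q_WB comm)

text \<open>These normalize words: A moves right, \<open>outer\<close> shortens, and projectors are
  absorbed where their argument already lies in the range. Later identities compare normal
  forms.\<close>

lemmas rules = comm outer P_B BWAWP Q_WB WBWAQ Q_idem Q_WP Q_WAQ

section \<open>Closed forms of the inverses\<close>

lemma wgdrazin_inverse_eq: "wgdrazin_inverse W A = B"
  unfolding wgdrazin_inverse_def
proof (rule the_equality)
  fix B' assume B': "is_wgdrazin_inverse W A B'"
  interpret B': wgdrazin W A B'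
    by unfold_locales (rule W_cb W_nz A_cb B')+
  have "B' (W y) = B (W y)" "W (B' x) = W (B x)" for x y
    using gdrazin_inverse_AW B'.gdrazin_inverse_AW gdrazin_inverse_WA B'.gdrazin_inverse_WA
    by (metis blinfun_apply_blinfun_compose)+
  \<comment> \<open>Writing B as \<open>B W B W A\<close> exposes factors \<open>B W\<close>, each
    of which equals \<open>B' W\<close>.\<close>
  thus "B' = B"
    by (intro blinfun_eqI) (metis outer comm B'.outer B'.comm)
qed (rule B)

lemma wcore_ep_inverse_eq: "wcore_ep_inverse W A = B o\<^sub>L Q"
  unfolding wcore_ep_inverse_def gdrazin_inverse_AW gdrazin_inverse_WA Q_def[symmetric]
proof (rule the_equality)
  have "W o\<^sub>L A o\<^sub>L W o\<^sub>L (B o\<^sub>L Q) = Q" by (rule blinfun_eqI) (simp add: rules)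
  \<comment> \<open>Inserting \<open>B W A W\<close>, the identity on \<open>R(B)\<close>, exposes
    the left factor \<open>B W\<close>.\<close>
  moreover have "(B o\<^sub>L Q) x = (B o\<^sub>L W) ((A o\<^sub>L W) (B (Q x)))" for x
    by (simp add: rules)
  hence "Ran (B o\<^sub>L Q) \<subseteq> Ran (B o\<^sub>L W)" unfolding Ran_def by (metis image_subsetI rangeI)
  ultimately show "B o\<^sub>L Q \<in> cblinops \<and> W o\<^sub>L A o\<^sub>L W o\<^sub>L (B o\<^sub>L Q) = Q \<and> Ran (B o\<^sub>L Q) \<subseteq> Ran (B o\<^sub>L W)"
    using B_cb Q_cb by (simp add: cblinops_compose)
next
  fix C assume C: "C \<in> cblinops \<and> W o\<^sub>L A o\<^sub>L W o\<^sub>L C = Q \<and> Ran C \<subseteq> Ran (B o\<^sub>L W)"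
  show "C = B o\<^sub>L Q"
  proof (rule blinfun_eqI)
    fix x
    have "C x \<in> Ran (B o\<^sub>L W)" using C by (auto simp: Ran_def)
    then obtain y where "C x = B (W y)" by (auto simp: Ran_def)
    hence "C x = B (W (A (W (C x))))" by (simp add: rules)
    also have "W (A (W (C x))) = Q x" using C by (metis blinfun_apply_blinfun_compose)
    finally show "C x = (B o\<^sub>L Q) x" by simp
  qed
qed

text \<open>The left one of the two projectors disappears because
  \<open>Q W B = W B\<close>.\<close>

lemma wweak_group_inverse_eq: "wweak_group_inverse W A = B o\<^sub>L W o\<^sub>L B o\<^sub>L Q o\<^sub>L W o\<^sub>L A"
  unfolding wweak_group_inverse_def wcore_ep_inverse_eq
  by (rule blinfun_eqI) (simp add: rules)

text \<open>The null space is unchanged by the extra left factor W, which is injective on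
  \<open>R(B)\<close>: there \<open>B W A\<close> undoes it.\<close>

lemma idem_proj_eq:
  "idem_proj (Ran (W o\<^sub>L B)) (Nul (B o\<^sub>L Q o\<^sub>L W o\<^sub>L A)) = W o\<^sub>L B o\<^sub>L Q o\<^sub>L W o\<^sub>L A"
proof (rule idem_proj_eqI)
  let ?E = "W o\<^sub>L B o\<^sub>L Q o\<^sub>L W o\<^sub>L A"
  show "?E \<in> cblinops" by (intro cblinops_compose W_cb B_cb Q_cb A_cb)
  show "?E o\<^sub>L ?E = ?E" by (rule blinfun_eqI) (simp add: rules)
  have "W (B x) = ?E (W (B x))" for x by (simp add: rules)
  hence "Ran (W o\<^sub>L B) \<subseteq> Ran ?E" by (auto simp: Ran_def)
  moreover have "Ran ?E \<subseteq> Ran (W o\<^sub>L B)" by (auto simp: Ran_def)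
  ultimately show "Ran ?E = Ran (W o\<^sub>L B)" by blast
  have "B y = B (W (A (W (B y))))" for y by (simp add: rules)
  hence "W (B y) = 0 \<longleftrightarrow> B y = 0" for y by (metis blinfun.zero_right)
  thus "Nul ?E = Nul (B o\<^sub>L Q o\<^sub>L W o\<^sub>L A)" by (auto simp: Nul_def)
qed

text \<open>W maps \<open>R((AW)^d)\<close> bijectively onto \<open>R((WA)^d)\<close> with inverse
  \<open>B W A\<close>, so the two products are Q and P, which are self-adjoint.\<close>

lemma is_mp_inverse_WP: "is_mp_inverse (W o\<^sub>L P) (B o\<^sub>L W o\<^sub>L A o\<^sub>L Q)"
proof -
  have P_idem: "P (P y) = P y" for y by (metis BWAWP P_B)
  have 1: "(W o\<^sub>L P) o\<^sub>L (B o\<^sub>L W o\<^sub>L A o\<^sub>L Q) = Q"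
    and 2: "(B o\<^sub>L W o\<^sub>L A o\<^sub>L Q) o\<^sub>L (W o\<^sub>L P) = P"
    by (rule blinfun_eqI, simp add: rules)+
  show ?thesis
    unfolding is_mp_inverse_def 1 2
    by (auto simp: rules P_idem P_sa Q_sa intro!: cblinops_compose W_cb B_cb A_cb Q_cb blinfun_eqI)
qed

lemma nontrivial: obtains x :: 'x and y :: 'y where "x \<noteq> 0" "y \<noteq> 0"
proof -
  obtain y where "W y \<noteq> 0" using W_nz by (metis blinfun.zero_left blinfun_eqI)
  moreover from this have "y \<noteq> 0" by (metis blinfun.zero_right)
  ultimately show ?thesis by (rule that)
qed

text \<open>\<open>Q W A\<close> agrees with \<open>W A\<close> on \<open>R(Q)\<close>, where
  \<open>W B\<close> inverts it; both products of the pair equal the idempotent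
  \<open>W B Q W A\<close>.\<close>

lemma group_inverse_QWA:
  shows "group_invertible (Q o\<^sub>L W o\<^sub>L A)"
    and "group_inverse (Q o\<^sub>L W o\<^sub>L A) = W o\<^sub>L B o\<^sub>L W o\<^sub>L B o\<^sub>L Q o\<^sub>L W o\<^sub>L A"
proof -
  obtain x :: 'x and y :: 'y where "x \<noteq> 0" "y \<noteq> 0" by (rule nontrivial)
  have "Q o\<^sub>L W o\<^sub>L A \<in> cblinops" "W o\<^sub>L B o\<^sub>L W o\<^sub>L B o\<^sub>L Q o\<^sub>L W o\<^sub>L A \<in> cblinops"
    by (intro cblinops_compose W_cb B_cb Q_cb A_cb)+
  note I = group_inverseI(2,3)[OF \<open>x \<noteq> 0\<close> this]
  show "group_invertible (Q o\<^sub>L W o\<^sub>L A)"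
    and "group_inverse (Q o\<^sub>L W o\<^sub>L A) = W o\<^sub>L B o\<^sub>L W o\<^sub>L B o\<^sub>L Q o\<^sub>L W o\<^sub>L A"
    by (rule I; rule blinfun_eqI; simp add: rules)+
qed

lemma core_ep_inverse_WA: "core_ep_inverse (W o\<^sub>L A) = W o\<^sub>L B o\<^sub>L Q"
  unfolding Q_def by (rule core_ep_inverse_eq[OF cblinops_compose[OF W_cb A_cb] gdrazin_WA])

text \<open>Squaring keeps the range of the Drazin inverse, so the projector is still Q.\<close>

lemma core_ep_inverse_WAWA:
  "core_ep_inverse ((W o\<^sub>L A) o\<^sub>L (W o\<^sub>L A)) = (W o\<^sub>L B) o\<^sub>L (W o\<^sub>L B) o\<^sub>L Q"
  unfolding Q_def
  using core_ep_inverse_eq is_gdrazin_inverse_square[OF _ gdrazin_WA]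
  by (metis cblinops_compose W_cb A_cb)

lemma core_ep_inverse_AWAW:
  "core_ep_inverse ((A o\<^sub>L W) o\<^sub>L (A o\<^sub>L W)) = (B o\<^sub>L W) o\<^sub>L (B o\<^sub>L W) o\<^sub>L P"
  unfolding P_def
  using core_ep_inverse_eq is_gdrazin_inverse_square[OF _ gdrazin_AW]
  by (metis cblinops_compose W_cb A_cb)

text \<open>T is \<open>(AW)^2\<close> times the idempotent \<open>(AW)(AW)^d\<close>, so its group
  inverse is the square of \<open>(AW)^d\<close>, with unchanged range. Its core inverse is thus the
  same word as the core-EP inverse of \<open>(AW)^2\<close>.\<close>

lemma core_inverse_AW3:
  defines "T \<equiv> (A o\<^sub>L W) o\<^sub>L (A o\<^sub>L W) o\<^sub>L (A o\<^sub>L W) o\<^sub>L (B o\<^sub>L W)"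
  shows "group_invertible T" "core_inverse T = (B o\<^sub>L W) o\<^sub>L (B o\<^sub>L W) o\<^sub>L P"
proof -
  obtain x :: 'x and y :: 'y where "x \<noteq> 0" "y \<noteq> 0" by (rule nontrivial)
  have cb: "T \<in> cblinops" "(B o\<^sub>L W) o\<^sub>L (B o\<^sub>L W) \<in> cblinops"
    unfolding T_def by (intro cblinops_compose W_cb B_cb A_cb)+
  have eqs: "T o\<^sub>L ((B o\<^sub>L W) o\<^sub>L (B o\<^sub>L W)) = ((B o\<^sub>L W) o\<^sub>L (B o\<^sub>L W)) o\<^sub>L T"
    "((B o\<^sub>L W) o\<^sub>L (B o\<^sub>L W)) o\<^sub>L T o\<^sub>L ((B o\<^sub>L W) o\<^sub>L (B o\<^sub>L W)) = (B o\<^sub>L W) o\<^sub>L (B o\<^sub>L W)"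
    "T o\<^sub>L T o\<^sub>L ((B o\<^sub>L W) o\<^sub>L (B o\<^sub>L W)) = T"
    unfolding T_def by (rule blinfun_eqI, simp add: rules)+
  note I = group_inverseI[OF \<open>y \<noteq> 0\<close> cb eqs]
  show "group_invertible T" by (rule I)
  have "Ran ((B o\<^sub>L W) o\<^sub>L (B o\<^sub>L W)) = Ran (B o\<^sub>L W)"
    by (rule is_gdrazin_inverse_square(2)[OF cblinops_compose[OF A_cb W_cb] gdrazin_AW])
  thus "core_inverse T = (B o\<^sub>L W) o\<^sub>L (B o\<^sub>L W) o\<^sub>L P"
    unfolding core_inverse_def core_ep_inverse_eq[OF cb(1) I(1)] P_def by simp
qed

end

section \<open>The seven representations\<close>

theorem theorem2p4:
  fixes A :: "'x::chilbert_space \<Rightarrow>\<^sub>L 'y::chilbert_space"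
    and W :: "'y \<Rightarrow>\<^sub>L 'x"
  assumes "infinite_cdim TYPE('x)" and "infinite_cdim TYPE('y)"
    and "W \<in> cblinops" and "W \<noteq> 0"
    and "A \<in> cblinops"
    and "wgdrazin_invertible W A"
  shows
   "\<comment> \<open>(i)\<close>
    wweak_group_inverse W A =
      wcore_ep_inverse W A o\<^sub>L
      idem_proj (Ran (W o\<^sub>L wgdrazin_inverse W A)) (Nul (wcore_ep_inverse W A o\<^sub>L W o\<^sub>L A))
    \<and>
    \<comment> \<open>(ii)\<close>
    wweak_group_inverse W A =
      wgdrazin_inverse W A o\<^sub>L
      idem_proj (Ran (W o\<^sub>L wgdrazin_inverse W A)) (Nul (wcore_ep_inverse W A o\<^sub>L W o\<^sub>L A))
    \<and>
    \<comment> \<open>(iii)\<close>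
    (mp_invertible (W o\<^sub>L orth_proj (Ran (gdrazin_inverse (A o\<^sub>L W)))) \<and>
     group_invertible (W o\<^sub>L A o\<^sub>L core_ep_inverse (W o\<^sub>L A) o\<^sub>L W o\<^sub>L A) \<and>
     wweak_group_inverse W A =
       mp_inverse (W o\<^sub>L orth_proj (Ran (gdrazin_inverse (A o\<^sub>L W)))) o\<^sub>L
       group_inverse (W o\<^sub>L A o\<^sub>L core_ep_inverse (W o\<^sub>L A) o\<^sub>L W o\<^sub>L A) \<and>
     wweak_group_inverse W A =
       mp_inverse (W o\<^sub>L orth_proj (Ran (gdrazin_inverse (A o\<^sub>L W)))) o\<^sub>L
       group_inverse (orth_proj (Ran (gdrazin_inverse (W o\<^sub>L A))) o\<^sub>L W o\<^sub>L A))
    \<and>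
    \<comment> \<open>(iv)\<close>
    (wweak_group_inverse W A =
       core_ep_inverse ((A o\<^sub>L W) o\<^sub>L (A o\<^sub>L W)) o\<^sub>L
       A o\<^sub>L W o\<^sub>L wcore_ep_inverse W A o\<^sub>L W o\<^sub>L A \<and>
     wweak_group_inverse W A =
       core_ep_inverse ((A o\<^sub>L W) o\<^sub>L (A o\<^sub>L W)) o\<^sub>L A o\<^sub>L
       idem_proj (Ran (W o\<^sub>L wgdrazin_inverse W A)) (Nul (wcore_ep_inverse W A o\<^sub>L W o\<^sub>L A)))
    \<and>
    \<comment> \<open>(v)\<close>
    (mp_invertible (W o\<^sub>L orth_proj (Ran (gdrazin_inverse (A o\<^sub>L W)))) \<and>
     wweak_group_inverse W A =
       gdrazin_inverse (A o\<^sub>L W) o\<^sub>L gdrazin_inverse (A o\<^sub>L W) o\<^sub>L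
       mp_inverse (W o\<^sub>L orth_proj (Ran (gdrazin_inverse (A o\<^sub>L W)))) o\<^sub>L W o\<^sub>L A)
    \<and>
    \<comment> \<open>(vi)\<close>
    (mp_invertible (W o\<^sub>L orth_proj (Ran (gdrazin_inverse (A o\<^sub>L W)))) \<and>
     wweak_group_inverse W A =
       mp_inverse (W o\<^sub>L orth_proj (Ran (gdrazin_inverse (A o\<^sub>L W)))) o\<^sub>L
       core_ep_inverse ((W o\<^sub>L A) o\<^sub>L (W o\<^sub>L A)) o\<^sub>L W o\<^sub>L A)
    \<and>
    \<comment> \<open>(vii)\<close>
    (group_invertible
       ((A o\<^sub>L W) o\<^sub>L (A o\<^sub>L W) o\<^sub>L (A o\<^sub>L W) o\<^sub>L gdrazin_inverse (A o\<^sub>L W)) \<and>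
     wweak_group_inverse W A =
       core_inverse
         ((A o\<^sub>L W) o\<^sub>L (A o\<^sub>L W) o\<^sub>L (A o\<^sub>L W) o\<^sub>L gdrazin_inverse (A o\<^sub>L W)) o\<^sub>L
       A o\<^sub>L W o\<^sub>L wcore_ep_inverse W A o\<^sub>L W o\<^sub>L A)"
proof -
  obtain B where "is_wgdrazin_inverse W A B"
    using assms(6) by (auto simp: wgdrazin_invertible_def)
  then interpret wgdrazin W A B
    using assms(3-5) by unfold_locales
  \<comment> \<open>\<open>W A\<close> times its core-EP inverse \<open>W B Q\<close> is Q, so both
    group inverses in (iii) belong to one operator.\<close>
  have QWA: "W o\<^sub>L A o\<^sub>L (W o\<^sub>L B o\<^sub>L Q) o\<^sub>L W o\<^sub>L A = Q o\<^sub>L W o\<^sub>L A"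
    by (rule blinfun_eqI) (simp add: rules)
  have "mp_invertible (W o\<^sub>L P)"
    using is_mp_inverse_WP by (auto simp: mp_invertible_def)
  thus ?thesis
    unfolding wgdrazin_inverse_eq gdrazin_inverse_AW gdrazin_inverse_WA P_def[symmetric] Q_def[symmetric]
      wcore_ep_inverse_eq core_ep_inverse_WA core_ep_inverse_WAWA core_ep_inverse_AWAW QWA
      idem_proj_eq wweak_group_inverse_eq mp_inverse_eqI[OF is_mp_inverse_WP]
      group_inverse_QWA(2) core_inverse_AW3(2)
    using group_inverse_QWA(1) core_inverse_AW3(1)
    by (auto intro!: blinfun_eqI simp: rules)
qed

end
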